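(* Let $\mathcal{A}$ be a graded Gorenstein algebra such that $2<\dim_{\mathbb{C}}\mathcal{A}<\infty$, with maximal ideal $\mathfrak{m}$ of nil-index $\nu$, and let $P$ be a nil-polynomial arising from $\mathcal{A}$. Further, for a fixed $s\in\{2,\dots,\nu\}$, let $W$ be a complex vector space isomorphic to $\mathfrak{m}/\mathfrak{m}^{\nu+2-s}$ by means of a linear map $\psi:W\to\mathfrak{m}/\mathfrak{m}^{\nu+2-s}$, and let $\mathcal{I}$ be an absolute invariant of forms of degree $s$ on $W$. Then the value $\mathcal{I}(\psi^*\hat P^{[s]})$ depends only on $\mathcal{I}$ and the isomorphism class of $\mathcal{A}$ (that is, whenever defined, it is the same for all choices of $P$ and $\psi$ and all graded Gorenstein algebras isomorphic to $\mathcal{A}$).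
   Context: A (complex) Gorenstein algebra is a local complex commutative associative unital algebra $\mathcal{A}$ with $1<\dim_{\mathbb{C}}\mathcal{A}<\infty$ and maximal ideal $\mathfrak{m}$ such that $\mathrm{Ann}(\mathfrak{m}):=\{u\in\mathfrak{m}:u\cdot\mathfrak{m}=0\}$ has complex dimension 1. It is called (non-negatively) graded if $\mathcal{A}=\bigoplus_{j\ge0}\mathcal{L}_j$ for linear subspaces $\mathcal{L}_j$ with $\mathcal{L}_j\mathcal{L}_k\subset\mathcal{L}_{j+k}$ and $\mathcal{L}_0\simeq\mathbb{C}$. The ideal $\mathfrak{m}$ is nilpotent; its nil-index $\nu$ is the largest integer $\mu$ with $\mathfrak{m}^\mu\neq0$. One has $\nu\ge2$ when $\dim_{\mathbb{C}}\mathcal{A}>2$, and $\mathrm{Ann}(\mathfrak{m})=\mathfrak{m}^\nu$. Let $\exp_2:\mathfrak{m}\to\mathfrak{m}$, $\exp_2(u):=\sum_{s=2}^{\infty}\frac{1}{s!}u^s$ (a finite sum). For a hyperplane $\Pi\subset\mathfrak{m}$ complementary to $\mathrm{Ann}(\mathfrak{m})$, a polynomial $P:\Pi\to\mathbb{C}$ is called a nil-polynomial arising from $\mathcal{A}$ if there is a linear form $\omega:\mathfrak{m}\to\mathbb{C}$ with $\omega(\mathrm{Ann}(\mathfrak{m}))=\mathbb{C}$, $\ker\omega=\Pi$ and $P=\omega\circ\exp_2|_\Pi$. It has degree $\nu$. For $s=2,\dots,\nu$, the degree-$s$ homogeneous component $P^{[s]}$ of $P$ extends to $\tilde P^{[s]}(u):=\frac{1}{s!}\omega(u^s)$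 on $\mathfrak{m}$, which satisfies $\tilde P^{[s]}(v)=0$ and $\tilde P^{[s]}(u+v)=\tilde P^{[s]}(u)$ for $u\in\mathfrak{m}$, $v\in\mathfrak{m}^{\nu+2-s}$; hence it induces a homogeneous polynomial $\hat P^{[s]}$ of degree $s$ on $\mathfrak{m}/\mathfrak{m}^{\nu+2-s}$. Here $\psi^*\hat P^{[s]}:=\hat P^{[s]}\circ\psi$. For a finite-dimensional complex vector space $W$, let $\mathcal{Q}_W^n$ be the space of forms (homogeneous polynomials) of degree $n\ge 2$ on $W$, with $\mathrm{GL}(W)$ acting by $Q_C(w):=Q(C^{-1}w)$. A (relative classical) invariant of forms of degree $n$ on $W$ is a polynomial $I:\mathcal{Q}_W^n\to\mathbb{C}$ for which there is a non-negative integer $k$ (the weight) with $I(Q)=(\det C)^kI(Q_C)$ for all $Q\in\mathcal{Q}_W^n$, $C\in\mathrm{GL}(W)$. An absolute invariant of forms of degree $n$ on $W$ is a rational function $I/\tilde I$ on $\mathcal{Q}_W^n$, where $I,\tilde I$ are invariants of equal weight and $\tilde I\not\equiv0$; it is defined, in particular, at points where $\tilde I$ does not vanish. *)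

theory Defs
  imports "Jordan_Normal_Form.Determinant" "HOL-Library.Function_Algebras"
begin

section \<open>Polynomials, forms and their invariants\<close>

definition linear_form_on ::
    "(complex \<Rightarrow> 'v::ab_group_add \<Rightarrow> 'v) \<Rightarrow> 'v set \<Rightarrow> ('v \<Rightarrow> complex) \<Rightarrow> bool" where
  "linear_form_on scale V f \<longleftrightarrow>
     (\<forall>x\<in>V. \<forall>y\<in>V. f (x + y) = f x + f y) \<and> (\<forall>c. \<forall>x\<in>V. f (scale c x) = c * f x)"

text \<open>Polynomial functions on a subspace \<open>V\<close>: the algebra generated by the constants and the linear
  forms on \<open>V\<close> (as for \<open>real_polynomial_function\<close> in HOL-Analysis). Values off \<open>V\<close> are irrelevant,
  as a function vanishing on \<open>V\<close> is a linear form on \<open>V\<close>.\<close>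

inductive polynomial_on ::
    "(complex \<Rightarrow> 'v::ab_group_add \<Rightarrow> 'v) \<Rightarrow> 'v set \<Rightarrow> ('v \<Rightarrow> complex) \<Rightarrow> bool"
  for scale V where
  linear: "linear_form_on scale V f \<Longrightarrow> polynomial_on scale V f"
| const: "polynomial_on scale V (\<lambda>_. c)"
| add: "polynomial_on scale V f \<Longrightarrow> polynomial_on scale V g \<Longrightarrow> polynomial_on scale V (\<lambda>x. f x + g x)"
| mult: "polynomial_on scale V f \<Longrightarrow> polynomial_on scale V g \<Longrightarrow> polynomial_on scale V (\<lambda>x. f x * g x)"

text \<open>Homogeneous polynomials, graded by degree. The zero function is homogeneous of every degree.\<close>

inductive homogeneous ::
    "(complex \<Rightarrow> 'w::ab_group_add \<Rightarrow> 'w) \<Rightarrow> nat \<Rightarrow> ('w \<Rightarrow> complex) \<Rightarrow> bool"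
  for scale where
  const: "homogeneous scale 0 (\<lambda>_. c)"
| linear: "linear_form_on scale UNIV f \<Longrightarrow> homogeneous scale 1 f"
| add: "homogeneous scale n f \<Longrightarrow> homogeneous scale n g \<Longrightarrow> homogeneous scale n (\<lambda>w. f w + g w)"
| mult: "homogeneous scale m f \<Longrightarrow> homogeneous scale n g \<Longrightarrow> homogeneous scale (m + n) (\<lambda>w. f w * g w)"

definition forms :: "(complex \<Rightarrow> 'w::ab_group_add \<Rightarrow> 'w) \<Rightarrow> nat \<Rightarrow> ('w \<Rightarrow> complex) set" where
  "forms scale n = {Q. homogeneous scale n Q}"

definition polynomial_on_forms ::
    "(complex \<Rightarrow> 'w::ab_group_add \<Rightarrow> 'w) \<Rightarrow> nat \<Rightarrow> (('w \<Rightarrow> complex) \<Rightarrow> complex) \<Rightarrow> bool" where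
  "polynomial_on_forms scale n = polynomial_on (\<lambda>c Q w. c * Q w) (forms scale n)"

definition GL :: "(complex \<Rightarrow> 'w::ab_group_add \<Rightarrow> 'w) \<Rightarrow> ('w \<Rightarrow> 'w) set" where
  "GL scale = {C. Vector_Spaces.linear scale scale C \<and> bij C}"

text \<open>The determinant of an endomorphism of a finite-dimensional space is that of its matrix with
  respect to any ordered basis; the choice of basis does not matter.\<close>

definition (in vector_space) lin_det :: "('b \<Rightarrow> 'b) \<Rightarrow> 'a" where
  "lin_det C =
     (let bs = (SOME bs. distinct bs \<and> independent (set bs) \<and> span (set bs) = UNIV);
          n = length bs
      in Determinant.det (mat n n (\<lambda>(i, j). representation (set bs) (C (bs ! j)) (bs ! i))))"

definition form_invariant ::
    "(complex \<Rightarrow> 'w::ab_group_add \<Rightarrow> 'w) \<Rightarrow> nat \<Rightarrow> nat \<Rightarrow> (('w \<Rightarrow> complex) \<Rightarrow> complex) \<Rightarrow> bool" where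
  "form_invariant scale n k I \<longleftrightarrow>
     polynomial_on_forms scale n I \<and>
     (\<forall>Q\<in>forms scale n. \<forall>C\<in>GL scale. I Q = vector_space.lin_det scale C ^ k * I (Q \<circ> inv_into UNIV C))"

text \<open>The rational function \<open>I / J\<close> on the space of forms, as a partial function. It is defined at
  \<open>Q\<close> iff it has a representation \<open>F / G\<close> by polynomials with \<open>G Q \<noteq> 0\<close>; in particular it is
  defined, with value \<open>I Q / J Q\<close>, whenever \<open>J Q \<noteq> 0\<close>. Since \<open>J\<close> is not identically
  zero, the value does not depend on the representation.\<close>

definition rational_value ::
    "(complex \<Rightarrow> 'w::ab_group_add \<Rightarrow> 'w) \<Rightarrow> nat \<Rightarrow> (('w \<Rightarrow> complex) \<Rightarrow> complex) \<Rightarrow>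
     (('w \<Rightarrow> complex) \<Rightarrow> complex) \<Rightarrow> ('w \<Rightarrow> complex) \<Rightarrow> complex \<Rightarrow> bool" where
  "rational_value scale n I J Q z \<longleftrightarrow>
     (\<exists>F G. polynomial_on_forms scale n F \<and> polynomial_on_forms scale n G \<and>
        (\<forall>R\<in>forms scale n. F R * J R = I R * G R) \<and> G Q \<noteq> 0 \<and> z = F Q / G Q)"

definition rational_function ::
    "(complex \<Rightarrow> 'w::ab_group_add \<Rightarrow> 'w) \<Rightarrow> nat \<Rightarrow> (('w \<Rightarrow> complex) \<Rightarrow> complex) \<Rightarrow>
     (('w \<Rightarrow> complex) \<Rightarrow> complex) \<Rightarrow> ('w \<Rightarrow> complex) \<rightharpoonup> complex" where
  "rational_function scale n I J Q =
     (if \<exists>z. rational_value scale n I J Q z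
      then Some (THE z. rational_value scale n I J Q z) else None)"

definition absolute_invariant ::
    "(complex \<Rightarrow> 'w::ab_group_add \<Rightarrow> 'w) \<Rightarrow> nat \<Rightarrow> (('w \<Rightarrow> complex) \<rightharpoonup> complex) \<Rightarrow> bool" where
  "absolute_invariant scale n \<I> \<longleftrightarrow>
     (\<exists>k I J. form_invariant scale n k I \<and> form_invariant scale n k J \<and>
        (\<exists>Q\<in>forms scale n. J Q \<noteq> 0) \<and>
        (\<forall>Q\<in>forms scale n. \<I> Q = rational_function scale n I J Q))"


section \<open>Gorenstein algebras\<close>

definition is_ideal :: "'a::comm_ring_1 set \<Rightarrow> bool" where
  "is_ideal I \<longleftrightarrow> 0 \<in> I \<and> (\<forall>x\<in>I. \<forall>y\<in>I. x + y \<in> I) \<and> (\<forall>a. \<forall>x\<in>I. a * x \<in> I)"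

definition is_maximal_ideal :: "'a::comm_ring_1 set \<Rightarrow> bool" where
  "is_maximal_ideal M \<longleftrightarrow>
     is_ideal M \<and> M \<noteq> UNIV \<and> (\<forall>J. is_ideal J \<and> M \<subseteq> J \<longrightarrow> J = M \<or> J = UNIV)"

definition ideal_prod :: "'a::comm_ring_1 set \<Rightarrow> 'a set \<Rightarrow> 'a set" where
  "ideal_prod I J = \<Inter>{K. is_ideal K \<and> (\<forall>x\<in>I. \<forall>y\<in>J. x * y \<in> K)}"

primrec ideal_pow :: "'a::comm_ring_1 set \<Rightarrow> nat \<Rightarrow> 'a set" where
  "ideal_pow I 0 = UNIV"
| "ideal_pow I (Suc n) = ideal_prod I (ideal_pow I n)"

definition Ann :: "'a::comm_ring_1 set \<Rightarrow> 'a set" where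
  "Ann M = {u\<in>M. \<forall>v\<in>M. u * v = 0}"

definition nil_index :: "'a::comm_ring_1 set \<Rightarrow> nat" where
  "nil_index M = (GREATEST \<mu>. ideal_pow M \<mu> \<noteq> {0})"

locale complex_algebra = vector_space scale
  for scale :: "complex \<Rightarrow> 'a::comm_ring_1 \<Rightarrow> 'a" +
  assumes scale_mult_left: "scale c (x * y) = scale c x * y"

locale gorenstein_algebra = complex_algebra scale
  for scale :: "complex \<Rightarrow> 'a::comm_ring_1 \<Rightarrow> 'a" and M :: "'a set" +
  assumes maximal: "is_maximal_ideal M"
    and local: "is_maximal_ideal N \<Longrightarrow> N = M"
    and finite_dim: "\<exists>B. finite B \<and> span B = UNIV"
    and dim_gt_1: "1 < dim (UNIV :: 'a set)"
    and dim_Ann: "dim (Ann M) = 1"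

context complex_algebra
begin

text \<open>As \<open>1\<close> lies in \<open>L 0\<close> for every such decomposition, \<open>dim (L 0) = 1\<close> says that \<open>L 0\<close>
  is isomorphic to the complex numbers, both as a vector space and as an algebra.\<close>

definition graded :: bool where
  "graded \<longleftrightarrow>
     (\<exists>L :: nat \<Rightarrow> 'a set.
        (\<forall>j. subspace (L j)) \<and>
        (\<forall>x. \<exists>!f. finite {j. f j \<noteq> 0} \<and> (\<forall>j. f j \<in> L j) \<and> x = (\<Sum>j | f j \<noteq> 0. f j)) \<and>
        (\<forall>j k. \<forall>x\<in>L j. \<forall>y\<in>L k. x * y \<in> L (j + k)) \<and>
        dim (L 0) = 1)"

text \<open>For nilpotent \<open>u\<close> this is the sum over all \<open>s \<ge> 2\<close>.\<close>

definition exp2 :: "'a \<Rightarrow> 'a" where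
  "exp2 u = (\<Sum>s | 2 \<le> s \<and> u ^ s \<noteq> 0. scale (1 / fact s) (u ^ s))"

text \<open>In a Gorenstein algebra \<open>Ann M\<close> is one-dimensional, so its complements in \<open>M\<close> are
  hyperplanes of \<open>M\<close>.\<close>

definition complementary_hyperplane :: "'a set \<Rightarrow> 'a set \<Rightarrow> bool" where
  "complementary_hyperplane M H \<longleftrightarrow>
     subspace H \<and> H \<subseteq> M \<and> H \<inter> Ann M = {0} \<and> (\<forall>u\<in>M. \<exists>p\<in>H. \<exists>a\<in>Ann M. u = p + a)"

definition nil_form :: "'a set \<Rightarrow> 'a set \<Rightarrow> ('a \<Rightarrow> complex) \<Rightarrow> ('a \<Rightarrow> complex) \<Rightarrow> bool" where
  "nil_form M H P \<omega> \<longleftrightarrow>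
     linear_form_on scale M \<omega> \<and> \<omega> ` Ann M = UNIV \<and> {u\<in>M. \<omega> u = 0} = H \<and>
     (\<forall>u\<in>H. P u = \<omega> (exp2 u))"

definition nil_polynomial :: "'a set \<Rightarrow> 'a set \<Rightarrow> ('a \<Rightarrow> complex) \<Rightarrow> bool" where
  "nil_polynomial M H P \<longleftrightarrow> complementary_hyperplane M H \<and> (\<exists>\<omega>. nil_form M H P \<omega>)"

definition quotient_space :: "'a set \<Rightarrow> 'a set \<Rightarrow> 'a set set" where
  "quotient_space V U = V // {(x, y). x \<in> V \<and> y \<in> V \<and> x - y \<in> U}"

text \<open>Linear isomorphisms onto a quotient; the operations on cosets are those of representatives.\<close>

definition quotient_iso ::
    "(complex \<Rightarrow> 'w::ab_group_add \<Rightarrow> 'w) \<Rightarrow> 'a set \<Rightarrow> 'a set \<Rightarrow> ('w \<Rightarrow> 'a set) \<Rightarrow> bool" where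
  "quotient_iso scaleW V U \<psi> \<longleftrightarrow>
     bij_betw \<psi> UNIV (quotient_space V U) \<and>
     (\<forall>v w. \<forall>x\<in>\<psi> v. \<forall>y\<in>\<psi> w. x + y \<in> \<psi> (v + w)) \<and>
     (\<forall>c v. \<forall>x\<in>\<psi> v. scale c x \<in> \<psi> (scaleW c v))"

text \<open>The polynomial that the degree-\<open>s\<close> component of \<open>P\<close> induces on \<open>M\<close> modulo the power
  \<open>nil_index M + 2 - s\<close> of \<open>M\<close>: a coset is sent to the common value on it of
  \<open>u \<mapsto> \<omega> (u ^ s) / s!\<close>. If \<open>nil_index M \<ge> 2\<close>, the restriction of \<open>\<omega>\<close> to \<open>M\<close> is uniquely
  determined by \<open>P\<close>, as \<open>\<omega>\<close> is determined up to a factor by its kernel and \<open>P\<close> is nonzero.\<close>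

definition nil_component :: "'a set \<Rightarrow> 'a set \<Rightarrow> ('a \<Rightarrow> complex) \<Rightarrow> nat \<Rightarrow> 'a set \<Rightarrow> complex" where
  "nil_component M H P s X =
     (let \<omega> = (SOME \<omega>. nil_form M H P \<omega>)
      in the_elem ((\<lambda>u. 1 / fact s * \<omega> (u ^ s)) ` X))"

end

definition algebra_iso ::
    "(complex \<Rightarrow> 'a::comm_ring_1 \<Rightarrow> 'a) \<Rightarrow> (complex \<Rightarrow> 'b::comm_ring_1 \<Rightarrow> 'b) \<Rightarrow> ('a \<Rightarrow> 'b) \<Rightarrow> bool" where
  "algebra_iso scaleA scaleB \<phi> \<longleftrightarrow>
     bij \<phi> \<and> Vector_Spaces.linear scaleA scaleB \<phi> \<and> (\<forall>x y. \<phi> (x * y) = \<phi> x * \<phi> y) \<and> \<phi> 1 = 1"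

definition algebras_isomorphic ::
    "(complex \<Rightarrow> 'a::comm_ring_1 \<Rightarrow> 'a) \<Rightarrow> (complex \<Rightarrow> 'b::comm_ring_1 \<Rightarrow> 'b) \<Rightarrow> bool" where
  "algebras_isomorphic scaleA scaleB \<longleftrightarrow> (\<exists>\<phi>. algebra_iso scaleA scaleB \<phi>)"

end

theory Submission
  imports Defs "HOL-Computational_Algebra.Fundamental_Theorem_Algebra"
begin

text \<open>The key fact is that the forms \<open>u \<mapsto> \<omega> (u ^ s)\<close> and \<open>u \<mapsto> \<omega>' (u ^ s)\<close> on the maximal ideal \<open>M\<close>
  of a Gorenstein algebra \<open>A\<close> differ only by an invertible linear substitution, whenever \<open>\<omega>\<close> and \<open>\<omega>'\<close>
  are linear forms that do not vanish on \<open>Ann M\<close>. Extend \<open>\<omega>\<close> and \<open>\<omega>'\<close> to \<open>A\<close>. Every nonzero ideal of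
  \<open>A\<close> contains the line \<open>Ann M\<close> (\<open>socle_multiple\<close>), so the pairing \<open>(x, y) \<mapsto> \<omega> (x * y)\<close> is
  nondegenerate and \<open>\<omega>' = \<omega> (a * _)\<close> for some \<open>a\<close>, which is a unit because \<open>\<omega>'\<close> does not vanish on
  \<open>Ann M\<close> (\<open>linear_forms_differ_by_unit\<close>). The residue field of \<open>A\<close> is the field of complex numbers
  and \<open>M\<close> consists of nilpotent elements, so \<open>a = b ^ s\<close> for a unit \<open>b\<close> (\<open>root_of_unit\<close>), and
  \<open>\<omega>' (u ^ s) = \<omega> ((b * u) ^ s)\<close>. The unit \<open>b\<close> depends on \<open>s\<close>, but only one degree is considered.

  Multiplication by \<open>b\<close> preserves \<open>M\<close> and its powers, hence induces an automorphism of
  \<open>M\<close> modulo the power \<open>nil_index M + 2 - s\<close> of \<open>M\<close>. The same holds for isomorphisms of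
  algebras, and two isomorphisms from \<open>W\<close> to the same quotient differ by an element of \<open>GL(W)\<close>.
  Therefore the two forms on \<open>W\<close> lie in one orbit of \<open>GL(W)\<close>, and on an orbit an absolute invariant
  is constant: the powers of the determinant cancel in the quotient of two invariants of equal
  weight (\<open>absolute_invariant_linearly_equivalent\<close>).\<close>


section \<open>Powers of an ideal\<close>

lemma is_ideal_zero: "is_ideal I \<Longrightarrow> 0 \<in> I"
  by (simp add: is_ideal_def)

lemma is_ideal_add: "is_ideal I \<Longrightarrow> x \<in> I \<Longrightarrow> y \<in> I \<Longrightarrow> x + y \<in> I"
  by (simp add: is_ideal_def)

lemma is_ideal_mult_left: "is_ideal I \<Longrightarrow> x \<in> I \<Longrightarrow> a * x \<in> I"
  by (simp add: is_ideal_def)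

lemma is_ideal_mult_right: "is_ideal I \<Longrightarrow> x \<in> I \<Longrightarrow> x * a \<in> I"
  using is_ideal_mult_left by (metis mult.commute)

lemma is_ideal_diff: "is_ideal I \<Longrightarrow> x \<in> I \<Longrightarrow> y \<in> I \<Longrightarrow> x - y \<in> I"
  using is_ideal_add[of I x "- 1 * y"] is_ideal_mult_left[of I y "- 1"] by simp

lemma is_ideal_sum: "is_ideal I \<Longrightarrow> (\<And>i. i \<in> S \<Longrightarrow> f i \<in> I) \<Longrightarrow> sum f S \<in> I"
  by (induction S rule: infinite_finite_induct) (auto intro: is_ideal_zero is_ideal_add)

lemma is_ideal_singleton_zero: "is_ideal {0}"
  by (simp add: is_ideal_def)

lemma is_ideal_UNIV: "is_ideal UNIV"
  by (simp add: is_ideal_def)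

lemma is_ideal_eq_UNIV: "is_ideal I \<Longrightarrow> 1 \<in> I \<Longrightarrow> I = UNIV"
  using is_ideal_mult_left[of I 1] by auto

lemma is_ideal_add_principal:
  assumes "is_ideal I"
  shows "is_ideal {x + a * y |x a. x \<in> I}"
  unfolding is_ideal_def
proof (intro conjI ballI allI)
  show "0 \<in> {x + a * y |x a. x \<in> I}"
    using is_ideal_zero[OF assms] by (auto intro!: exI[of _ 0])
next
  fix u v assume "u \<in> {x + a * y |x a. x \<in> I}" "v \<in> {x + a * y |x a. x \<in> I}"
  then obtain x a x' a' where "u = x + a * y" "v = x' + a' * y" "x \<in> I" "x' \<in> I"
    by blast
  then have "u + v = (x + x') + (a + a') * y" "x + x' \<in> I"
    using assms by (auto simp: algebra_simps intro: is_ideal_add)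
  then show "u + v \<in> {x + a * y |x a. x \<in> I}" by blast
next
  fix c u assume "u \<in> {x + a * y |x a. x \<in> I}"
  then obtain x a where "u = x + a * y" "x \<in> I" by blast
  then have "c * u = c * x + (c * a) * y" "c * x \<in> I"
    using assms by (auto simp: algebra_simps intro: is_ideal_mult_left)
  then show "c * u \<in> {x + a * y |x a. x \<in> I}" by blast
qed

lemma is_ideal_ideal_prod: "is_ideal (ideal_prod I J)"
  unfolding ideal_prod_def is_ideal_def by auto

lemma ideal_prod_mem: "x \<in> I \<Longrightarrow> y \<in> J \<Longrightarrow> x * y \<in> ideal_prod I J"
  by (auto simp: ideal_prod_def)

lemma ideal_prod_subset:
  "is_ideal K \<Longrightarrow> (\<And>x y. x \<in> I \<Longrightarrow> y \<in> J \<Longrightarrow> x * y \<in> K) \<Longrightarrow> ideal_prod I J \<subseteq> K"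
  by (auto simp: ideal_prod_def)

lemma is_ideal_ideal_pow: "is_ideal (ideal_pow I n)"
  by (cases n) (simp_all add: is_ideal_UNIV is_ideal_ideal_prod)

lemma ideal_pow_add_mem:
  "x \<in> ideal_pow I m \<Longrightarrow> y \<in> ideal_pow I n \<Longrightarrow> x * y \<in> ideal_pow I (m + n)"
proof (induction m arbitrary: x y)
  case 0
  then show ?case by (simp add: is_ideal_mult_left is_ideal_ideal_pow)
next
  case (Suc m)
  let ?K = "{z. z * y \<in> ideal_pow I (Suc m + n)}"
  have "ideal_prod I (ideal_pow I m) \<subseteq> ?K"
  proof (rule ideal_prod_subset)
    show "is_ideal ?K"
      using is_ideal_ideal_pow[of I "Suc m + n"]
      by (auto simp: is_ideal_def distrib_right mult.assoc simp del: ideal_pow.simps)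
    show "u * v \<in> ?K" if "u \<in> I" "v \<in> ideal_pow I m" for u v
      using ideal_prod_mem[OF that(1) Suc.IH[OF that(2) Suc.prems(2)]] by (simp add: mult.assoc)
  qed
  with Suc.prems(1) show ?case by auto
qed

lemma power_mem_ideal_pow: "x \<in> I \<Longrightarrow> x ^ n \<in> ideal_pow I n"
  by (induction n) (auto intro: ideal_prod_mem)

lemma ideal_pow_Suc_subset: "ideal_pow I (Suc n) \<subseteq> ideal_pow I n"
  unfolding ideal_pow.simps
  by (rule ideal_prod_subset) (simp_all add: is_ideal_ideal_pow is_ideal_mult_left)

lemma ideal_pow_antimono: "m \<le> n \<Longrightarrow> ideal_pow I n \<subseteq> ideal_pow I m"
  by (rule lift_Suc_antimono_le[of "ideal_pow I", OF ideal_pow_Suc_subset])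

lemma is_ideal_power_mem: "is_ideal I \<Longrightarrow> x \<in> I \<Longrightarrow> 0 < n \<Longrightarrow> x ^ n \<in> I"
  by (cases n) (auto intro: is_ideal_mult_right)

lemma power_diff_mem_ideal_pow:
  assumes "is_ideal I" "x \<in> I" "y \<in> I" "x - y \<in> ideal_pow I k"
  shows "x ^ Suc n - y ^ Suc n \<in> ideal_pow I (k + n)"
proof -
  have "y ^ (Suc n - Suc i) * x ^ i \<in> ideal_pow I n" if "i \<in> {..<Suc n}" for i
    using ideal_pow_add_mem[OF power_mem_ideal_pow[OF assms(3), of "n - i"]
        power_mem_ideal_pow[OF assms(2), of i]] that by simp
  then show ?thesis
    unfolding power_diff_sumr2
    by (intro ideal_pow_add_mem assms(4) is_ideal_sum[OF is_ideal_ideal_pow])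
qed

subsection \<open>Transport along ring isomorphisms\<close>

locale ring_iso =
  fixes \<phi> :: "'a::comm_ring_1 \<Rightarrow> 'b::comm_ring_1"
  assumes bij: "bij \<phi>"
    and map_add: "\<phi> (x + y) = \<phi> x + \<phi> y"
    and map_mult: "\<phi> (x * y) = \<phi> x * \<phi> y"
    and map_one: "\<phi> 1 = 1"
begin

lemma map_zero: "\<phi> 0 = 0"
  using map_add[of 0 0] by simp

lemma map_power: "\<phi> (x ^ n) = \<phi> x ^ n"
  by (induction n) (simp_all add: map_one map_mult)

lemma ring_iso_inv: "ring_iso (inv_into UNIV \<phi>)"
proof
  have s: "\<phi> (inv_into UNIV \<phi> y) = y" for y
    using bij by (simp add: bij_is_surj surj_f_inv_f)
  have i: "inv_into UNIV \<phi> (\<phi> x) = x" for x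
    using bij by (simp add: bij_is_inj)
  show "bij (inv_into UNIV \<phi>)" using bij by (rule bij_imp_bij_inv)
  show "inv_into UNIV \<phi> (x + y) = inv_into UNIV \<phi> x + inv_into UNIV \<phi> y" for x y
    by (metis s i map_add)
  show "inv_into UNIV \<phi> (x * y) = inv_into UNIV \<phi> x * inv_into UNIV \<phi> y" for x y
    by (metis s i map_mult)
  show "inv_into UNIV \<phi> 1 = 1"
    by (metis i map_one)
qed

lemma image_mem_iff: "\<phi> x \<in> \<phi> ` S \<longleftrightarrow> x \<in> S"
  using bij by (simp add: bij_is_inj inj_image_mem_iff)

lemma vimage_ideal: "is_ideal K \<Longrightarrow> is_ideal (\<phi> -` K)"
  by (auto simp: is_ideal_def map_zero map_add map_mult)

end

text \<open>The image under \<open>\<phi>\<close> is the preimage under its inverse, which is again an isomorphism.\<close>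

lemma (in ring_iso) image_ideal: "is_ideal K \<Longrightarrow> is_ideal (\<phi> ` K)"
  using ring_iso.vimage_ideal[OF ring_iso_inv, of K] bij
  by (simp add: bij_vimage_eq_inv_image[OF bij_imp_bij_inv] inv_inv_eq)

context ring_iso
begin

lemma image_vimage: "\<phi> ` (\<phi> -` K) = K"
  using bij by (simp add: bij_is_surj)

lemma image_ideal_prod: "\<phi> ` ideal_prod I J = ideal_prod (\<phi> ` I) (\<phi> ` J)"
proof (rule antisym)
  have "ideal_prod I J \<subseteq> \<phi> -` ideal_prod (\<phi> ` I) (\<phi> ` J)"
    by (rule ideal_prod_subset)
      (auto simp: map_mult intro: vimage_ideal is_ideal_ideal_prod ideal_prod_mem)
  then show "\<phi> ` ideal_prod I J \<subseteq> ideal_prod (\<phi> ` I) (\<phi> ` J)" by auto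
  show "ideal_prod (\<phi> ` I) (\<phi> ` J) \<subseteq> \<phi> ` ideal_prod I J"
    by (rule ideal_prod_subset)
      (auto simp: map_mult[symmetric] intro: image_ideal is_ideal_ideal_prod ideal_prod_mem)
qed

lemma image_ideal_pow: "\<phi> ` ideal_pow I n = ideal_pow (\<phi> ` I) n"
  using bij by (induction n) (simp_all add: image_ideal_prod bij_is_surj)

lemma image_maximal_ideal:
  assumes "is_maximal_ideal M"
  shows "is_maximal_ideal (\<phi> ` M)"
  unfolding is_maximal_ideal_def
proof (intro conjI allI impI)
  show "is_ideal (\<phi> ` M)"
    using assms by (simp add: is_maximal_ideal_def image_ideal)
  show "\<phi> ` M \<noteq> UNIV"
    using assms bij by (metis bij_def inj_image_eq_iff is_maximal_ideal_def)
  fix J assume J: "is_ideal J \<and> \<phi> ` M \<subseteq> J"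
  then have "is_ideal (\<phi> -` J)" "M \<subseteq> \<phi> -` J"
    by (auto intro: vimage_ideal)
  then have "\<phi> -` J = M \<or> \<phi> -` J = UNIV"
    using assms by (simp add: is_maximal_ideal_def)
  then show "J = \<phi> ` M \<or> J = UNIV"
    using image_vimage[of J] bij by (metis bij_is_surj)
qed

lemma nil_index_image: "nil_index (\<phi> ` M) = nil_index M"
proof -
  have "ideal_pow (\<phi> ` M) k \<noteq> {0} \<longleftrightarrow> ideal_pow M k \<noteq> {0}" for k
    using bij by (metis image_ideal_pow map_zero image_empty image_insert bij_def inj_image_eq_iff)
  then show ?thesis by (simp add: nil_index_def)
qed

lemma image_Ann: "\<phi> ` Ann M = Ann (\<phi> ` M)"
proof -
  have "\<phi> x = 0 \<longleftrightarrow> x = 0" for x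
    using bij map_zero by (metis bij_def injD)
  then show ?thesis by (auto simp: Ann_def map_mult[symmetric])
qed

end


section \<open>Roots of units\<close>

lemma complex_root_exists:
  assumes "0 < n"
  shows "\<exists>d::complex. d ^ n = c"
proof -
  have "\<not> constant (poly (monom 1 n + [:- c:]))"
    using assms degree_add_eq_left[of "[:- c:]" "monom 1 n"]
    by (simp add: constant_degree degree_monom_eq)
  then obtain d where "poly (monom 1 n + [:- c:]) d = 0"
    using fundamental_theorem_of_algebra by blast
  then show ?thesis by (auto simp: poly_monom)
qed

lemma one_plus_nilpotent_invertible:
  fixes x :: "'a::comm_ring_1"
  assumes "x ^ k = 0"
  shows "\<exists>z. (1 + x) * z = 1"
proof -
  have "(1 + x) * (\<Sum>i<k. (- x) ^ i) = 1"
    using one_diff_power_eq[of "- x" k] assms by (simp add: power_minus')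
  then show ?thesis ..
qed

context complex_algebra
begin

lemma scale_eq_mult: "scale c x = scale c 1 * x"
  using scale_mult_left[of c 1 x] by simp

lemma mult_scale_right: "x * scale c y = scale c (x * y)"
  using scale_mult_left[of c y x] by (simp add: mult.commute)

lemma scale_power: "scale c x ^ n = scale (c ^ n) (x ^ n)"
  by (induction n) (simp_all add: scale_mult_left[symmetric] mult_scale_right mult.commute)

lemma linear_mult_left: "Vector_Spaces.linear scale scale ((*) a)"
  by (simp add: Vector_Spaces.linear_iff vector_space_axioms distrib_left mult_scale_right)

lemma ideal_scale: "is_ideal I \<Longrightarrow> x \<in> I \<Longrightarrow> scale c x \<in> I"
  by (subst scale_eq_mult) (rule is_ideal_mult_left)

lemma subspace_ideal: "is_ideal I \<Longrightarrow> subspace I"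
  by (auto simp: subspace_def is_ideal_zero is_ideal_add ideal_scale)

lemma one_plus_power: "\<exists>r. (1 + t) ^ n = 1 + scale (of_nat n) t + t ^ 2 * r"
proof (induction n)
  case 0
  have "(1 + t) ^ 0 = 1 + scale (of_nat 0) t + t ^ 2 * 0" by simp
  then show ?case by blast
next
  case (Suc n)
  then obtain r where r: "(1 + t) ^ n = 1 + scale (of_nat n) t + t ^ 2 * r" ..
  have "scale (of_nat n) t = scale (of_nat n) 1 * t" "scale (of_nat (Suc n)) t = t + scale (of_nat n) 1 * t"
    by (simp_all add: scale_left_distrib scale_eq_mult[of "of_nat n" t])
  then have "(1 + t) ^ Suc n = 1 + scale (of_nat (Suc n)) t + t ^ 2 * (scale (of_nat n) 1 + r + t * r)"
    unfolding power_Suc r by (simp only:) (simp add: algebra_simps power2_eq_square)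
  then show ?case by blast
qed

text \<open>Newton iteration for the equation \<open>b ^ n = 1 + x\<close>: after division by \<open>(1 + x / n) ^ n\<close> the
  nilpotent part \<open>x\<close> is replaced by a multiple of \<open>x\<^sup>2\<close>, whose order of nilpotency is smaller.\<close>

lemma root_of_unipotent:
  fixes x :: 'a
  assumes "0 < n" "x ^ k = 0"
  shows "\<exists>b. b ^ n = 1 + x"
  using assms(2)
proof (induction k arbitrary: x rule: less_induct)
  case (less k)
  show ?case
  proof (cases "k \<le> 1")
    case True
    then have "x = 0"
      using less.prems by (cases k) auto
    then show ?thesis by (intro exI[of _ 1]) simp
  next
    case False
    define t where "t = scale (1 / of_nat n) x"
    obtain r where r: "(1 + t) ^ n = 1 + scale (of_nat n) t + t ^ 2 * r"
      using one_plus_power by blast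
    have "t ^ k = 0"
      by (simp add: t_def scale_power less.prems)
    then obtain z where z: "(1 + t) * z = 1"
      using one_plus_nilpotent_invertible by blast
    define y where "y = - (t ^ 2 * r) * z ^ n"
    have zn: "(1 + t) ^ n * z ^ n = 1"
      by (metis z power_mult_distrib power_one)
    have "scale (of_nat n) t = x"
      using \<open>0 < n\<close> by (simp add: t_def)
    with r have "1 + x = (1 + t) ^ n - t ^ 2 * r"
      by simp
    also have "\<dots> = (1 + t) ^ n + (- (t ^ 2 * r)) * ((1 + t) ^ n * z ^ n)"
      by (simp add: zn)
    also have "\<dots> = (1 + t) ^ n * (1 + y)"
      by (simp add: y_def algebra_simps)
    finally have x: "1 + x = (1 + t) ^ n * (1 + y)" .
    \<comment> \<open>Already \<open>k \<le> 2 * (k - 1)\<close> for \<open>k \<ge> 2\<close>, so an exponent smaller than \<open>k\<close> kills \<open>t\<^sup>2\<close>.\<close>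
    define j where "j = k - 1"
    have j: "j < k" "k \<le> 2 * j" using False by (auto simp: j_def)
    have "(t ^ 2) ^ j = 0"
      using \<open>t ^ k = 0\<close> j(2) by (metis le_Suc_ex mult_zero_left power_add power_mult)
    then have y: "y ^ j = 0"
      by (simp add: y_def power_mult_distrib power_minus')
    then obtain b where "b ^ n = 1 + y"
      using less.IH[OF j(1) y] by blast
    then have "((1 + t) * b) ^ n = 1 + x"
      by (simp add: power_mult_distrib x)
    then show ?thesis ..
  qed
qed

end


section \<open>Finite-dimensional local algebras\<close>

context gorenstein_algebra
begin

sublocale finite_dimensional_vector_space scale "SOME B. finite B \<and> independent B \<and> span B = UNIV"
proof -
  obtain B where "B \<subseteq> UNIV" "independent B" "UNIV \<subseteq> span B"
    using basis_exists[of UNIV] by metis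
  moreover have "finite B"
    using finite_dim independent_span_bound[OF _ \<open>independent B\<close>] by fastforce
  ultimately have "finite B \<and> independent B \<and> span B = UNIV"
    by auto
  from someI[of "\<lambda>B. finite B \<and> independent B \<and> span B = UNIV", OF this]
  show "finite_dimensional_vector_space scale (SOME B. finite B \<and> independent B \<and> span B = UNIV)"
    by unfold_locales auto
qed

lemma ideal_M: "is_ideal M"
  using maximal by (simp add: is_maximal_ideal_def)

lemma one_notin_M: "1 \<notin> M"
  using maximal is_ideal_eq_UNIV by (auto simp: is_maximal_ideal_def)

text \<open>A proper ideal of largest dimension among those containing \<open>I\<close> is a maximal ideal.\<close>

lemma proper_ideal_subset_M:
  assumes "is_ideal I" "1 \<notin> I"
  shows "I \<subseteq> M"
proof -
  obtain J where J: "is_ideal J" "I \<subseteq> J" "1 \<notin> J"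
    and max: "\<And>K. is_ideal K \<Longrightarrow> I \<subseteq> K \<Longrightarrow> 1 \<notin> K \<Longrightarrow> dim K \<le> dim J"
    using Lattices_Big.ex_has_greatest_nat[of "\<lambda>J. is_ideal J \<and> I \<subseteq> J \<and> 1 \<notin> J" I dim
        "Suc dimension"] assms dim_subset_UNIV
    by (metis (lifting) le_imp_less_Suc subset_refl)
  have "is_maximal_ideal J"
    unfolding is_maximal_ideal_def
  proof (intro conjI allI impI)
    show "is_ideal J" "J \<noteq> UNIV" using J by auto
    fix K assume K: "is_ideal K \<and> J \<subseteq> K"
    show "K = J \<or> K = UNIV"
    proof (cases "1 \<in> K")
      case True
      with K show ?thesis by (simp add: is_ideal_eq_UNIV)
    next
      case False
      with K J have "dim K \<le> dim J" by (intro max) auto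
      with K J(1) have "J = K" by (intro subspace_dim_equal subspace_ideal) auto
      then show ?thesis by simp
    qed
  qed
  with J(2) local show ?thesis by blast
qed

lemma invertible_iff_notin_M: "(\<exists>y. x * y = 1) \<longleftrightarrow> x \<notin> M"
proof
  assume "\<exists>y. x * y = 1"
  then show "x \<notin> M"
    using is_ideal_mult_right[OF ideal_M, of x] one_notin_M by metis
next
  assume x: "x \<notin> M"
  have "is_ideal (range ((*) x))"
    unfolding is_ideal_def
  proof (intro conjI ballI allI)
    show "0 \<in> range ((*) x)" by (rule range_eqI[of _ _ 0]) simp
    show "u + v \<in> range ((*) x)" if "u \<in> range ((*) x)" "v \<in> range ((*) x)" for u v
      using that by (auto simp: distrib_left[symmetric])
    show "a * u \<in> range ((*) x)" if "u \<in> range ((*) x)" for a u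
      using that by (auto simp: mult.left_commute[of a])
  qed
  moreover have "x \<in> range ((*) x)" by (rule range_eqI[of _ _ 1]) simp
  ultimately have "1 \<in> range ((*) x)"
    using proper_ideal_subset_M x by blast
  then show "\<exists>y. x * y = 1" by force
qed

text \<open>Nakayama's lemma for a cyclic module: \<open>1 - n\<close> is a unit.\<close>

lemma eq_mult_M_imp_zero:
  assumes "y = y * n" "n \<in> M"
  shows "y = 0"
proof -
  have "1 - n \<notin> M"
    using is_ideal_add[OF ideal_M _ assms(2), of "1 - n"] one_notin_M by auto
  then obtain z where z: "(1 - n) * z = 1"
    using invertible_iff_notin_M by blast
  have "y = y * ((1 - n) * z)" by (simp add: z)
  also have "\<dots> = (y - y * n) * z" by (simp add: algebra_simps)
  finally show ?thesis using assms(1) by simp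
qed

text \<open>The subspaces \<open>x ^ k A\<close> decrease, so \<open>x ^ k = x ^ (k + 1) * y\<close> for some \<open>k\<close> and \<open>y\<close>; as
  \<open>1 - x * y\<close> is a unit, \<open>x ^ k\<close> vanishes.\<close>

lemma nilpotent_of_mem_M:
  assumes "x \<in> M"
  shows "\<exists>k. x ^ k = 0"
proof -
  let ?V = "\<lambda>k. range ((*) (x ^ k))"
  obtain k where min: "\<And>j. dim (?V k) \<le> dim (?V j)"
    using ex_has_least_nat[of "\<lambda>_. True" 0 "\<lambda>k. dim (?V k)"] by auto
  have sub: "subspace (?V j)" for j
    unfolding subspace_def
  proof (intro conjI ballI allI)
    show "0 \<in> ?V j" by (rule range_eqI[of _ _ 0]) simp
    show "u + v \<in> ?V j" if "u \<in> ?V j" "v \<in> ?V j" for u v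
      using that by (auto simp: distrib_left[symmetric])
    show "scale c u \<in> ?V j" if "u \<in> ?V j" for c u
      using that by (auto simp: mult_scale_right[symmetric])
  qed
  have "?V (Suc k) \<subseteq> ?V k"
    by (auto simp: mult.assoc mult.left_commute[of x])
  then have "?V (Suc k) = ?V k"
    using min sub by (intro subspace_dim_equal)
  moreover have "x ^ k \<in> ?V k" by (rule range_eqI[of _ _ 1]) simp
  ultimately obtain y where "x ^ k = x ^ Suc k * y" by auto
  then have "x ^ k = x ^ k * (x * y)" by (simp add: mult_ac)
  moreover have "x * y \<in> M" using ideal_M assms by (rule is_ideal_mult_right)
  ultimately show ?thesis using eq_mult_M_imp_zero by blast
qed

text \<open>Multiply \<open>y\<close> by the largest possible power of each member of a finite spanning set of the
  maximal ideal in turn. For \<open>I = {0}\<close> this produces a socle element in the ideal generated by \<open>y\<close>.\<close>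

lemma socle_multiple:
  assumes I: "is_ideal I" and y: "y \<notin> I"
  shows "\<exists>r. r * y \<notin> I \<and> (\<forall>n\<in>M. n * (r * y) \<in> I)"
proof -
  obtain B where B: "B \<subseteq> M" "independent B" "M \<subseteq> span B"
    using basis_exists[of M] by metis
  have "finite B" using B(2) by (rule finiteI_independent)
  then have "\<exists>r. r * y \<notin> I \<and> (\<forall>b\<in>B. b * (r * y) \<in> I)"
    using B(1)
  proof (induction B rule: finite_induct)
    case empty
    show ?case by (rule exI[of _ 1]) (simp add: y)
  next
    case (insert b B)
    then obtain r where r: "r * y \<notin> I" "\<forall>b\<in>B. b * (r * y) \<in> I" by auto
    obtain k where "b ^ k = 0" using nilpotent_of_mem_M insert.prems by auto
    then have "b ^ k * (r * y) \<in> I" by (simp add: is_ideal_zero[OF I])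
    define e where "e = (LEAST e. b ^ e * (r * y) \<in> I)"
    have e: "b ^ e * (r * y) \<in> I"
      unfolding e_def by (rule LeastI) fact
    have e0: "e \<noteq> 0" using e r(1) by (metis mult_1 power_0)
    have "b ^ (e - 1) * (r * y) \<notin> I"
      using not_less_Least[of "e - 1" "\<lambda>e. b ^ e * (r * y) \<in> I"] e0 unfolding e_def[symmetric] by auto
    moreover have "b * (b ^ (e - 1) * (r * y)) \<in> I"
      using e e0 by (cases e) (simp_all add: mult.assoc)
    moreover have "b' * (b ^ (e - 1) * (r * y)) \<in> I" if "b' \<in> B" for b'
      using is_ideal_mult_left[OF I, of "b' * (r * y)" "b ^ (e - 1)"] r(2) that
      by (simp add: mult.left_commute)
    ultimately show ?case
      by (intro exI[of _ "b ^ (e - 1) * r"]) (simp add: mult.assoc)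
  qed
  then obtain r where r: "r * y \<notin> I" "\<forall>b\<in>B. b * (r * y) \<in> I" by blast
  have "subspace {n. n * (r * y) \<in> I}"
    using subspace_ideal[OF I] by (auto simp: subspace_def distrib_right scale_mult_left[symmetric])
  then have "span B \<subseteq> {n. n * (r * y) \<in> I}"
    using r(2) by (intro span_minimal) auto
  with B(3) r(1) show ?thesis by blast
qed

text \<open>A proper ideal \<open>I\<close> can be enlarged by an element \<open>y\<close> with \<open>M y \<subseteq> I\<close>; if the larger ideal
  contains \<open>M ^ N\<close>, then \<open>I\<close> contains \<open>M ^ (N + 1)\<close>. For \<open>I = {0}\<close> this shows that \<open>M\<close> is
  nilpotent, which makes \<open>nil_index M\<close> a genuine maximum.\<close>

lemma ideal_pow_subset_ideal:
  assumes "is_ideal I"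
  shows "\<exists>N. ideal_pow M N \<subseteq> I"
  using assms
proof (induction "dimension - dim I" arbitrary: I rule: less_induct)
  case less
  show ?case
  proof (cases "I = UNIV")
    case False
    then have "1 \<notin> I" using less.prems is_ideal_eq_UNIV by blast
    then obtain y where y: "y \<notin> I" "\<forall>n\<in>M. n * y \<in> I"
      using socle_multiple[OF less.prems] by blast
    define J where "J = {x + a * y |x a. x \<in> I}"
    have J: "is_ideal J"
      unfolding J_def using less.prems by (rule is_ideal_add_principal)
    have "x + 0 * y \<in> J" if "x \<in> I" for x
      unfolding J_def using that by blast
    then have "I \<subseteq> J" by auto
    moreover have "0 + 1 * y \<in> J"
      unfolding J_def using is_ideal_zero[OF less.prems] by blast
    ultimately have "I \<subset> J" using y(1) by auto
    then have "dim I < dim J"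
      using less.prems J by (intro dim_psubset) (metis span_eq_iff subspace_ideal)
    then have "dimension - dim J < dimension - dim I"
      using dim_subset_UNIV[of J] by linarith
    then obtain N where N: "ideal_pow M N \<subseteq> J" using less.hyps J by blast
    have "ideal_prod M (ideal_pow M N) \<subseteq> I"
    proof (rule ideal_prod_subset)
      show "n * z \<in> I" if n: "n \<in> M" and z: "z \<in> ideal_pow M N" for n z
      proof -
        obtain x a where z: "z = x + a * y" "x \<in> I" using N z by (auto simp: J_def)
        have "n * z = n * x + a * (n * y)" by (simp add: z algebra_simps)
        then show ?thesis
          using less.prems z(2) y(2) n by (auto intro: is_ideal_add is_ideal_mult_left)
      qed
    qed fact
    then show ?thesis by (intro exI[of _ "Suc N"]) simp
  qed auto
qed

lemma ideal_pow_Suc_nil_index: "ideal_pow M (Suc (nil_index M)) = {0}"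
proof (rule ccontr)
  assume *: "ideal_pow M (Suc (nil_index M)) \<noteq> {0}"
  obtain N where N: "ideal_pow M N \<subseteq> {0}"
    using ideal_pow_subset_ideal[OF is_ideal_singleton_zero] by blast
  have "k \<le> N" if "ideal_pow M k \<noteq> {0}" for k
  proof (rule ccontr)
    assume "\<not> k \<le> N"
    then have "ideal_pow M k \<subseteq> {0}" using ideal_pow_antimono[of N k M] N by auto
    with that show False using is_ideal_zero[OF is_ideal_ideal_pow] by blast
  qed
  with * have "Suc (nil_index M) \<le> nil_index M"
    unfolding nil_index_def[of M, abs_def] by (intro Greatest_le_nat) auto
  then show False by simp
qed

subsection \<open>The residue field\<close>

text \<open>More powers of \<open>x\<close> than the dimension either repeat or are linearly dependent.\<close>

lemma annihilating_polynomial: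
  "\<exists>p. p \<noteq> 0 \<and> poly (map_poly (\<lambda>c. scale c 1) p) x = 0"
proof -
  have poly_eq: "poly (map_poly (\<lambda>c. scale c 1) p) x = (\<Sum>i\<le>n. scale (coeff p i) (x ^ i))"
    if "degree p \<le> n" for p n
  proof -
    have "poly (map_poly (\<lambda>c. scale c 1) p) x = (\<Sum>i\<le>degree p. scale (coeff p i) (x ^ i))"
      by (simp add: poly_altdef degree_map_poly coeff_map_poly scale_mult_left[symmetric])
    also have "\<dots> = (\<Sum>i\<le>n. scale (coeff p i) (x ^ i))"
      using that by (intro sum.mono_neutral_left) (auto simp: coeff_eq_0)
    finally show ?thesis .
  qed
  let ?d = "dimension"
  show ?thesis
  proof (cases "inj_on (\<lambda>i. x ^ i) {..?d}")
    case True
    then have "card ((\<lambda>i. x ^ i) ` {..?d}) > dim ((\<lambda>i. x ^ i) ` {..?d})"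
      using dim_subset_UNIV[of "(\<lambda>i. x ^ i) ` {..?d}"] by (simp add: card_image)
    then have "dependent ((\<lambda>i. x ^ i) ` {..?d})"
      by (intro dependent_biggerset_general)
    then obtain u j where u: "(\<Sum>v\<in>(\<lambda>i. x ^ i) ` {..?d}. scale (u v) v) = 0" "j \<le> ?d" "u (x ^ j) \<noteq> 0"
      by (auto simp: dependent_finite)
    define p where "p = (\<Sum>i\<le>?d. monom (u (x ^ i)) i)"
    have c: "coeff p i = (if i \<le> ?d then u (x ^ i) else 0)" for i
      by (simp add: p_def coeff_sum sum.delta' if_distrib cong: if_cong)
    have "degree p \<le> ?d" by (rule degree_le) (simp add: c)
    moreover have "(\<Sum>i\<le>?d. scale (coeff p i) (x ^ i)) = 0"
      using u(1) by (simp add: sum.reindex[OF True] c)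
    moreover have "p \<noteq> 0" using u(2,3) c[of j] by auto
    ultimately show ?thesis using poly_eq by auto
  next
    case False
    then obtain i j where ij: "x ^ i = x ^ j" "i \<noteq> j" by (auto simp: inj_on_def)
    define p :: "complex poly" where "p = monom 1 i - monom 1 j"
    have "coeff p i \<noteq> 0" using ij by (simp add: p_def)
    then have "p \<noteq> 0" by auto
    have "degree p \<le> i + j"
      unfolding p_def by (rule degree_le) auto
    have "(\<Sum>k\<le>i + j. scale (coeff p k) (x ^ k)) = x ^ i - x ^ j"
      by (simp add: p_def scale_left_diff_distrib sum_subtractf if_distrib[of "\<lambda>c. scale c _"] sum.delta
          cong: if_cong)
    then show ?thesis using poly_eq[OF \<open>degree p \<le> i + j\<close>] \<open>p \<noteq> 0\<close> ij by auto
  qed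
qed

text \<open>A polynomial of minimal degree annihilating \<open>x\<close> has a root \<open>c\<close>, and \<open>x - c\<close> is then a zero
  divisor: it kills the value at \<open>x\<close> of the quotient by \<open>X - c\<close>.\<close>

lemma scalar_mod_M: "\<exists>c. x - scale c 1 \<in> M"
proof -
  let ?ev = "\<lambda>p. poly (map_poly (\<lambda>c. scale c 1) p) x"
  have ev_pCons: "?ev (pCons c p) = scale c 1 + x * ?ev p" for c p
    by (simp add: map_poly_pCons)
  have ev_add: "?ev (p + q) = ?ev p + ?ev q" for p q
    by (induction p q rule: poly_induct2)
      (simp_all add: ev_pCons scale_left_distrib algebra_simps del: map_poly_pCons)
  have ev_smult: "?ev (smult c p) = scale c (?ev p)" for c p
    by (induction p) (simp_all add: ev_pCons scale_right_distrib mult_scale_right)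
  obtain p where p: "p \<noteq> 0" "?ev p = 0"
    and min: "\<And>q. q \<noteq> 0 \<Longrightarrow> ?ev q = 0 \<Longrightarrow> degree p \<le> degree q"
    using ex_has_least_nat[of "\<lambda>p. p \<noteq> 0 \<and> ?ev p = 0" _ degree] annihilating_polynomial[of x] by metis
  have "\<not> constant (poly p)"
  proof
    assume "constant (poly p)"
    then obtain c where c: "p = [:c:]" using constant_degree degree_eq_zeroE by metis
    with p(2) have "scale c 1 = 0" using ev_pCons[of c 0] by simp
    then show False using c p(1) by simp
  qed
  then obtain c where "poly p c = 0" using fundamental_theorem_of_algebra by blast
  then obtain q where q: "p = [:- c, 1:] * q" by (auto simp: poly_eq_0_iff_dvd dvd_def)
  have q0: "q \<noteq> 0" using p(1) q by auto
  then have "degree q < degree p" by (simp add: q degree_mult_eq del: mult_pCons_left)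
  then have ev_q: "?ev q \<noteq> 0" using min q0 by force
  have "p = smult (- c) q + pCons 0 q" by (simp add: q)
  then have "?ev p = scale (- c) (?ev q) + (scale 0 1 + x * ?ev q)"
    by (simp only: ev_add ev_smult ev_pCons)
  then have "(x - scale c 1) * ?ev q = 0"
    using p(2) by (simp add: algebra_simps scale_eq_mult[of c "?ev q"])
  then have "((x - scale c 1) * z) * ?ev q = 0" for z
    by (simp only: mult.assoc mult.left_commute[of _ z] mult_zero_right)
  then have "(x - scale c 1) * z \<noteq> 1" for z
    using ev_q by (metis mult_1)
  then show ?thesis using invertible_iff_notin_M by blast
qed

text \<open>Modulo \<open>M\<close> the unit \<open>a\<close> is a nonzero scalar \<open>c\<close>, so it is the product of \<open>c\<close> and a unipotent
  element, each of which has an \<open>n\<close>-th root.\<close>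

lemma root_of_unit:
  assumes "a \<notin> M" "0 < n"
  shows "\<exists>b. b \<notin> M \<and> b ^ n = a"
proof -
  obtain c where c: "a - scale c 1 \<in> M" using scalar_mod_M by blast
  with assms(1) have "c \<noteq> 0" by auto
  define x where "x = scale (1 / c) (a - scale c 1)"
  have "x \<in> M" unfolding x_def by (rule ideal_scale[OF ideal_M c])
  then obtain k where "x ^ k = 0" using nilpotent_of_mem_M by blast
  then obtain b where b: "b ^ n = 1 + x" using root_of_unipotent[OF assms(2)] by blast
  obtain d where d: "d ^ n = c"
    using complex_root_exists[OF assms(2)] by blast
  have "scale d b ^ n = scale c (1 + x)" by (simp add: scale_power d b)
  also have "\<dots> = a" using \<open>c \<noteq> 0\<close> by (simp add: x_def scale_right_distrib)
  finally have "scale d b ^ n = a" .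
  moreover from this have "scale d b \<notin> M"
    using assms is_ideal_power_mem[OF ideal_M] by metis
  ultimately show ?thesis by blast
qed

subsection \<open>Linear forms and multiplication by units\<close>

lemma extend_linear_form_on:
  assumes "subspace V" "linear_form_on scale V \<omega>"
  shows "\<exists>f. Vector_Spaces.linear scale (*) f \<and> (\<forall>x\<in>V. f x = \<omega> x)"
proof -
  interpret p: vector_space_pair scale "(*) :: complex \<Rightarrow> _"
    by unfold_locales (simp_all add: algebra_simps)
  obtain B where B: "B \<subseteq> V" "independent B" "V \<subseteq> span B"
    using basis_exists[of V] by metis
  obtain f where f: "Vector_Spaces.linear scale (*) f" "\<forall>x\<in>B. f x = \<omega> x"
    using p.linear_independent_extend[OF B(2)] by blast
  have "0 \<in> V" using assms(1) by (rule subspace_0)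
  have zero: "\<omega> 0 = 0"
    using assms(2) \<open>0 \<in> V\<close> scale_zero_left[of 0] unfolding linear_form_on_def by (metis mult_zero_left)
  have "subspace {x \<in> V. f x = \<omega> x}"
    using assms f(1) zero unfolding linear_form_on_def
    by (auto simp: subspace_def p.linear_0 p.linear_add p.linear_scale)
  then have "span B \<subseteq> {x \<in> V. f x = \<omega> x}"
    using f(2) B(1) by (intro span_minimal) auto
  with B(3) f(1) show ?thesis by blast
qed

lemma Ann_subset_span:
  assumes "z \<in> Ann M" "z \<noteq> 0"
  shows "Ann M \<subseteq> span {z}"
  using card_eq_dim[of "{z}" "Ann M"] assms dim_Ann by simp

lemma Ann_nontrivial: "\<exists>z\<in>Ann M. z \<noteq> 0"
  using dim_Ann dim_eq_0[of "Ann M"] by auto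

text \<open>As \<open>Ann M\<close> is a line, a form that does not vanish on it is nonzero at any nonzero socle
  element, and the ideal generated by \<open>y\<close> contains one.\<close>

lemma pairing_nondegenerate:
  assumes lin: "Vector_Spaces.linear scale (*) f"
    and u: "u \<in> Ann M" "f u \<noteq> 0" and y: "y \<noteq> 0"
  shows "\<exists>r. f (r * y) \<noteq> 0"
proof -
  interpret f: Vector_Spaces.linear scale "(*)" f by (fact lin)
  obtain r where r: "r * y \<noteq> 0" "\<forall>n\<in>M. n * (r * y) = 0"
    using socle_multiple[OF is_ideal_singleton_zero, of y] y by auto
  have "r * y \<in> M"
  proof (rule ccontr)
    assume "r * y \<notin> M"
    then obtain t where "(r * y) * t = 1" using invertible_iff_notin_M by blast
    obtain z where z: "z \<in> Ann M" "z \<noteq> 0" using Ann_nontrivial by blast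
    then have "z * (r * y) = 0" using r(2) by (simp add: Ann_def)
    with \<open>(r * y) * t = 1\<close> z(2) show False by (metis mult.assoc mult.right_neutral mult_zero_left)
  qed
  then have "r * y \<in> Ann M" using r(2) by (simp add: Ann_def mult.commute)
  then have "u \<in> span {r * y}" using Ann_subset_span r(1) u(1) by blast
  then obtain c where "u = scale c (r * y)" by (auto simp: span_singleton)
  then show ?thesis using u(2) f.scale by auto
qed

text \<open>The pairing \<open>(x, y) \<mapsto> f (x * y)\<close> is nondegenerate, so on the finite-dimensional space \<open>A\<close>
  every linear form is \<open>f (a * _)\<close> for some \<open>a\<close>; as \<open>g\<close> does not kill the annihilator of \<open>M\<close>,
  this \<open>a\<close> cannot lie in \<open>M\<close>.\<close>

lemma linear_forms_differ_by_unit: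
  assumes f: "Vector_Spaces.linear scale (*) f" and g: "Vector_Spaces.linear scale (*) g"
    and u: "u \<in> Ann M" "f u \<noteq> 0" and v: "v \<in> Ann M" "g v \<noteq> 0"
  shows "\<exists>a. a \<notin> M \<and> (\<forall>x. g x = f (a * x))"
proof -
  interpret p: vector_space_pair scale "(*) :: complex \<Rightarrow> _"
    by unfold_locales (simp_all add: algebra_simps)
  obtain B where B: "finite B" "independent B" "span B = UNIV"
    using finite_Basis independent_Basis span_Basis by blast
  have lin_mult: "Vector_Spaces.linear scale (*) (\<lambda>x. f (a * x))" for a
    using Vector_Spaces.linear_compose[OF linear_mult_left f] by (simp add: comp_def)
  \<comment> \<open>In place of the dual space the coordinates of \<open>f (a * _)\<close> are recorded as a vector of \<open>A\<close>.\<close>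
  define T where "T a = (\<Sum>b\<in>B. scale (f (a * b)) b)" for a
  have rep: "representation B (\<Sum>b\<in>B. scale (c b) b) b' = c b'" if "b' \<in> B" for c b'
  proof -
    have "(\<Sum>b | (if b \<in> B then c b else 0) \<noteq> 0. scale (if b \<in> B then c b else 0) b) = (\<Sum>b\<in>B. scale (c b) b)"
      using B(1) by (intro sum.mono_neutral_cong_left) (auto split: if_splits)
    moreover have "finite {b. (if b \<in> B then c b else 0) \<noteq> 0}"
      using B(1) by (rule rev_finite_subset) (auto split: if_splits)
    ultimately have "representation B (\<Sum>b\<in>B. scale (c b) b) = (\<lambda>b. if b \<in> B then c b else 0)"
      using B(2,3) by (intro representation_eqI) (auto split: if_splits)
    with that show ?thesis by simp
  qed
  have T_lin: "Vector_Spaces.linear scale scale T"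
    unfolding Vector_Spaces.linear_iff
  proof (intro conjI allI vector_space_axioms)
    show "T (x + y) = T x + T y" for x y
      by (simp only: T_def distrib_right p.linear_add[OF f] scale_left_distrib sum.distrib)
    show "T (scale c x) = scale c (T x)" for c x
      by (simp only: T_def scale_mult_left[symmetric] p.linear_scale[OF f] scale_sum_right scale_scale)
  qed
  interpret T: Vector_Spaces.linear scale scale T by (fact T_lin)
  have "inj T"
    unfolding T.inj_iff_eq_0
  proof (intro allI impI)
    fix y assume "T y = 0"
    then have "f (y * b) = 0" if "b \<in> B" for b
      using rep[OF that, of "\<lambda>b. f (y * b)"] by (simp add: T_def representation_zero)
    then have "f (y * x) = 0" for x
      using p.linear_eq_0_on_span[OF lin_mult, of B y x] B(3) by simp
    then show "y = 0" using pairing_nondegenerate[OF f u] by (metis mult.commute)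
  qed
  then have "surj T" using T_lin linear_inj_imp_surj by blast
  then obtain a where a: "T a = (\<Sum>b\<in>B. scale (g b) b)" by (metis surjD)
  have "g b = f (a * b)" if "b \<in> B" for b
    using rep[OF that, of g] rep[OF that, of "\<lambda>b. f (a * b)"] a by (simp add: T_def)
  then have eq: "g x = f (a * x)" for x
    using p.linear_eq_on[OF g lin_mult, of x B a] B(3) by simp
  have "a \<notin> M"
    using v eq[of v] p.linear_0[OF f] by (auto simp: Ann_def mult.commute)
  with eq show ?thesis by blast
qed

text \<open>Write \<open>\<omega>' = \<omega> (a * _)\<close> with a unit \<open>a\<close> and extract an \<open>s\<close>-th root \<open>b\<close> of \<open>a\<close>.\<close>

lemma power_forms_differ_by_unit:
  assumes "linear_form_on scale M \<omega>" "\<omega> ` Ann M = UNIV"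
    and "linear_form_on scale M \<omega>'" "\<omega>' ` Ann M = UNIV" and "0 < s"
  shows "\<exists>b. b \<notin> M \<and> (\<forall>u\<in>M. \<omega>' (u ^ s) = \<omega> ((b * u) ^ s))"
proof -
  have V: "subspace M" using ideal_M by (rule subspace_ideal)
  obtain f where f: "Vector_Spaces.linear scale (*) f" "\<forall>x\<in>M. f x = \<omega> x"
    using extend_linear_form_on[OF V assms(1)] by blast
  obtain g where g: "Vector_Spaces.linear scale (*) g" "\<forall>x\<in>M. g x = \<omega>' x"
    using extend_linear_form_on[OF V assms(3)] by blast
  obtain u v where uv: "u \<in> Ann M" "\<omega> u = 1" "v \<in> Ann M" "\<omega>' v = 1"
    using assms(2,4) by (metis UNIV_I imageE)
  then have "f u \<noteq> 0" "g v \<noteq> 0" using f(2) g(2) by (auto simp: Ann_def)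
  then obtain a where a: "a \<notin> M" "\<And>x. g x = f (a * x)"
    using linear_forms_differ_by_unit[OF f(1) g(1)] uv by blast
  obtain b where b: "b \<notin> M" "b ^ s = a" using root_of_unit[OF a(1) assms(5)] by blast
  have "\<omega>' (u ^ s) = \<omega> ((b * u) ^ s)" if "u \<in> M" for u
  proof -
    have "u ^ s \<in> M" "(b * u) ^ s \<in> M"
      using that assms(5) by (auto intro!: is_ideal_power_mem ideal_M is_ideal_mult_left)
    then show ?thesis using f(2) g(2) a(2)[of "u ^ s"] b(2) by (simp add: power_mult_distrib)
  qed
  with b(1) show ?thesis by blast
qed

end


section \<open>The components of a nil-polynomial as forms\<close>

text \<open>The coset of \<open>x\<close> is \<open>\<psi> w\<close> for a unique \<open>w\<close>, which depends linearly on \<open>x\<close>.\<close>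

lemma (in complex_algebra) quotient_iso_linear_map:
  assumes q: "quotient_iso scaleW V U \<psi>" and W: "vector_space scaleW"
    and V: "subspace V" and U: "subspace U" "U \<subseteq> V"
  obtains \<pi> where "Vector_Spaces.linear scale scaleW \<pi>" "\<And>w. \<psi> w = {x \<in> V. \<pi> x = w}"
    "\<pi> ` V = UNIV" "\<And>x. x \<in> V \<Longrightarrow> \<pi> x = 0 \<longleftrightarrow> x \<in> U"
proof -
  interpret p: vector_space_pair scale scaleW
    using W by (simp add: vector_space_pair_def vector_space_axioms)
  have \<psi>: "bij_betw \<psi> UNIV (quotient_space V U)"
    "\<And>v w x y. x \<in> \<psi> v \<Longrightarrow> y \<in> \<psi> w \<Longrightarrow> x + y \<in> \<psi> (v + w)"
    "\<And>c v x. x \<in> \<psi> v \<Longrightarrow> scale c x \<in> \<psi> (scaleW c v)"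
    using q unfolding quotient_iso_def by blast+
  define coset where "coset z = {y \<in> V. z - y \<in> U}" for z
  have quot: "quotient_space V U = coset ` V"
    by (auto simp: quotient_space_def quotient_def coset_def)
  have coset_self: "z \<in> coset z" if "z \<in> V" for z
    using that U(1) by (simp add: coset_def subspace_0)
  have coset_eq: "coset z = coset x" if "x \<in> coset z" for x z
  proof -
    have zx: "z - x \<in> U" using that by (simp add: coset_def)
    then have "z - y \<in> U \<longleftrightarrow> x - y \<in> U" for y
      using subspace_diff[OF U(1) _ zx, of "z - y"] subspace_add[OF U(1) zx, of "x - y"] by auto
    then show ?thesis by (auto simp: coset_def)
  qed
  define \<pi>0 where "\<pi>0 x = inv_into UNIV \<psi> (coset x)" for x
  have \<psi>_\<pi>0: "\<psi> (\<pi>0 x) = coset x" if "x \<in> V" for x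
    using \<psi>(1) that unfolding \<pi>0_def quot
    by (intro f_inv_into_f) (simp add: bij_betw_def)
  have mem: "x \<in> \<psi> w \<longleftrightarrow> x \<in> V \<and> \<pi>0 x = w" for x w
  proof
    assume x: "x \<in> \<psi> w"
    have "\<psi> w \<in> coset ` V" using \<psi>(1) quot by (metis bij_betw_def rangeI)
    then obtain z where z: "\<psi> w = coset z" by blast
    with x have "\<psi> w = coset x" "x \<in> V" using coset_eq by (auto simp: coset_def)
    then show "x \<in> V \<and> \<pi>0 x = w"
      using \<psi>(1) \<psi>_\<pi>0 by (metis bij_betw_def injD)
  next
    assume "x \<in> V \<and> \<pi>0 x = w"
    then show "x \<in> \<psi> w" using \<psi>_\<pi>0 coset_self by auto
  qed
  have add: "\<pi>0 (x + y) = \<pi>0 x + \<pi>0 y" if "x \<in> V" "y \<in> V" for x y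
    using \<psi>(2)[of x "\<pi>0 x" y "\<pi>0 y"] that by (simp add: mem)
  have scl: "\<pi>0 (scale c x) = scaleW c (\<pi>0 x)" if "x \<in> V" for c x
    using \<psi>(3)[of x "\<pi>0 x" c] that by (simp add: mem)
  have zero: "\<pi>0 0 = 0"
    using scl[of 0 0] subspace_0[OF V] by simp
  have ker: "\<pi>0 x = 0 \<longleftrightarrow> x \<in> U" if "x \<in> V" for x
  proof -
    have "\<pi>0 x = 0 \<longleftrightarrow> x \<in> \<psi> (\<pi>0 0)" using that by (simp add: mem zero)
    also have "\<dots> \<longleftrightarrow> - x \<in> U"
      using that subspace_0[OF V] by (simp add: \<psi>_\<pi>0 coset_def)
    also have "\<dots> \<longleftrightarrow> x \<in> U" using subspace_neg[OF U(1)] by force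
    finally show ?thesis .
  qed
  have "w \<in> \<pi>0 ` V" for w
  proof -
    have "\<psi> w \<in> coset ` V" using \<psi>(1) quot by (metis bij_betw_def rangeI)
    then obtain z where "z \<in> \<psi> w" using coset_self by auto
    then show ?thesis by (auto simp: mem)
  qed
  then have surj: "\<pi>0 ` V = UNIV" by blast
  obtain B where B: "B \<subseteq> V" "independent B" "V \<subseteq> span B"
    using basis_exists[of V] by metis
  obtain \<pi> where \<pi>: "Vector_Spaces.linear scale scaleW \<pi>" "\<forall>x\<in>B. \<pi> x = \<pi>0 x"
    using p.linear_independent_extend[OF B(2)] by blast
  have "subspace {x \<in> V. \<pi> x = \<pi>0 x}"
    using V \<pi>(1) by (auto simp: subspace_def zero add scl p.linear_0 p.linear_add p.linear_scale)
  then have "span B \<subseteq> {x \<in> V. \<pi> x = \<pi>0 x}"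
    using \<pi>(2) B(1) by (intro span_minimal) auto
  then have eq: "\<pi> x = \<pi>0 x" if "x \<in> V" for x using B(3) that by blast
  then have "\<psi> w = {x \<in> V. \<pi> x = w}" for w by (auto simp: mem)
  moreover have "\<pi> ` V = UNIV" using surj eq by (metis image_cong)
  ultimately show thesis using \<pi>(1) eq ker that[of \<pi>] by simp
qed

lemma homogeneous_zero: "homogeneous scale n (\<lambda>_. 0)"
proof (induction n)
  case 0
  show ?case by (rule homogeneous.const)
next
  case (Suc n)
  have "homogeneous scale 1 (\<lambda>_. 0)"
    by (rule homogeneous.linear) (simp add: linear_form_on_def)
  from homogeneous.mult[OF this Suc] show ?case by simp
qed

lemma homogeneous_sum:
  assumes "finite S" "\<And>i. i \<in> S \<Longrightarrow> homogeneous scale n (f i)"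
  shows "homogeneous scale n (\<lambda>w. \<Sum>i\<in>S. f i w)"
  using assms
  by (induction S rule: finite_induct) (simp_all add: homogeneous_zero homogeneous.add)

text \<open>Expanding one factor \<open>l w\<close> in a basis of the algebra splits off the coordinates of \<open>l w\<close>, which
  are linear forms in \<open>w\<close>. The factor \<open>z\<close> absorbs the basis vectors in the induction.\<close>

lemma (in gorenstein_algebra) homogeneous_power:
  assumes W: "vector_space scaleW" and l: "Vector_Spaces.linear scaleW scale l"
    and f: "Vector_Spaces.linear scale (*) f"
  shows "homogeneous scaleW n (\<lambda>w. f (z * l w ^ n))"
proof (induction n arbitrary: z)
  case 0
  show ?case by (simp add: homogeneous.const)
next
  case (Suc n)
  interpret p: vector_space_pair scale "(*) :: complex \<Rightarrow> _"
    by unfold_locales (simp_all add: algebra_simps)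
  interpret l: Vector_Spaces.linear scaleW scale l by (fact l)
  obtain B where B: "finite B" "independent B" "span B = UNIV"
    using finite_Basis independent_Basis span_Basis by blast
  define c where "c b w = representation B (l w) b" for b w
  have "homogeneous scaleW 1 (c b)" for b
    by (rule homogeneous.linear)
      (simp add: linear_form_on_def c_def l.add l.scale representation_add representation_scale B)
  then have "homogeneous scaleW (1 + n) (\<lambda>w. c b w * f (z * b * l w ^ n))" for b
    by (intro homogeneous.mult Suc.IH)
  then have "homogeneous scaleW (Suc n) (\<lambda>w. \<Sum>b\<in>B. c b w * f (z * b * l w ^ n))"
    using B(1) by (intro homogeneous_sum) simp_all
  moreover have "f (z * l w ^ Suc n) = (\<Sum>b\<in>B. c b w * f (z * b * l w ^ n))" for w
  proof -
    have "l w = (\<Sum>b\<in>B. scale (c b w) b)"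
      unfolding c_def using B by (subst sum_representation_eq) auto
    then have "l w * (z * l w ^ n) = (\<Sum>b\<in>B. scale (c b w) b) * (z * l w ^ n)"
      by (rule arg_cong)
    also have "\<dots> = (\<Sum>b\<in>B. scale (c b w) (z * b * l w ^ n))"
      unfolding sum_distrib_right
      by (rule sum.cong) (simp_all add: scale_mult_left[symmetric] mult_scale_right mult_ac)
    finally have "z * l w ^ Suc n = (\<Sum>b\<in>B. scale (c b w) (z * b * l w ^ n))"
      by (simp add: mult.left_commute)
    then show ?thesis
      by (simp only: p.linear_sum[OF f] p.linear_scale[OF f])
  qed
  ultimately show ?case by simp
qed

text \<open>Representatives of a coset differ by an element of \<open>M ^ (nil_index M + 2 - s)\<close>, hence their
  \<open>s\<close>-th powers by an element of \<open>M ^ (nil_index M + 1) = {0}\<close>.\<close>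

lemma (in gorenstein_algebra) nil_component_eq:
  assumes \<pi>: "Vector_Spaces.linear scale scaleW \<pi>" "\<And>w. \<psi> w = {x \<in> M. \<pi> x = w}"
    "\<And>x. x \<in> M \<Longrightarrow> \<pi> x = 0 \<Longrightarrow> x \<in> ideal_pow M (nil_index M + 2 - s)"
    and s: "s \<in> {2..nil_index M}" and x: "x \<in> M"
  shows "nil_component M H P s (\<psi> (\<pi> x)) = 1 / fact s * (SOME \<omega>. nil_form M H P \<omega>) (x ^ s)"
proof -
  interpret \<pi>: Vector_Spaces.linear scale scaleW \<pi> by (fact \<pi>(1))
  define \<omega> where "\<omega> = (SOME \<omega>. nil_form M H P \<omega>)"
  have eq: "y ^ s = x ^ s" if y: "y \<in> \<psi> (\<pi> x)" for y
  proof -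
    have "y \<in> M" "\<pi> (y - x) = 0" using y by (simp_all add: \<pi>(2) \<pi>.diff)
    then have "y ^ Suc (s - 1) - x ^ Suc (s - 1) \<in> ideal_pow M (nil_index M + 2 - s + (s - 1))"
      by (intro power_diff_mem_ideal_pow \<pi>(3) is_ideal_diff ideal_M x)
    moreover have "nil_index M + 2 - s + (s - 1) = Suc (nil_index M)" "Suc (s - 1) = s"
      using s by auto
    ultimately show ?thesis using ideal_pow_Suc_nil_index by simp
  qed
  have "(\<lambda>u. 1 / fact s * \<omega> (u ^ s)) ` \<psi> (\<pi> x) = (\<lambda>_. 1 / fact s * \<omega> (x ^ s)) ` \<psi> (\<pi> x)"
    by (rule image_cong[OF refl], drule eq, simp only:)
  also have "\<dots> = {1 / fact s * \<omega> (x ^ s)}"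
    by (rule image_constant[of x]) (simp add: \<pi>(2) x)
  finally have "(\<lambda>u. 1 / fact s * \<omega> (u ^ s)) ` \<psi> (\<pi> x) = {1 / fact s * \<omega> (x ^ s)}" .
  then show ?thesis by (simp add: nil_component_def \<omega>_def)
qed

text \<open>Along a linear section of \<open>\<pi>\<close> the function \<open>Q\<close> becomes the power of a linear map, followed by a
  linear form.\<close>

lemma (in gorenstein_algebra) nil_component_mem_forms:
  assumes W: "vector_space scaleW" and \<pi>: "Vector_Spaces.linear scale scaleW \<pi>" "\<pi> ` M = UNIV"
    and \<omega>: "linear_form_on scale M \<omega>" and s: "0 < s"
    and Q: "\<And>x. x \<in> M \<Longrightarrow> Q (\<pi> x) = c * \<omega> (x ^ s)"
  shows "Q \<in> forms scaleW s"
proof -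
  interpret p: vector_space_pair scale scaleW
    using W by (simp add: vector_space_pair_def vector_space_axioms)
  have V: "subspace M" using ideal_M by (rule subspace_ideal)
  obtain l where l: "range l \<subseteq> M" "Vector_Spaces.linear scaleW scale l" "\<And>w. \<pi> (l w) = w"
    using p.linear_exists_right_inverse_on[OF \<pi>(1) V] \<pi>(2) by auto
  obtain f where f: "Vector_Spaces.linear scale (*) f" "\<forall>x\<in>M. f x = \<omega> x"
    using extend_linear_form_on[OF V \<omega>] by blast
  have "Q = (\<lambda>w. c * f (1 * l w ^ s))"
  proof
    fix w
    have "l w \<in> M" using l(1) by auto
    moreover from this have "l w ^ s \<in> M" using s by (intro is_ideal_power_mem ideal_M)
    ultimately show "Q w = c * f (1 * l w ^ s)" using Q[of "l w"] l(3)[of w] f(2) by simp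
  qed
  moreover have "homogeneous scaleW (0 + s) (\<lambda>w. c * f (1 * l w ^ s))"
    by (intro homogeneous.mult homogeneous.const homogeneous_power W l(2) f(1))
  ultimately have "homogeneous scaleW (0 + s) Q" by (simp only:)
  then show ?thesis by (simp add: forms_def)
qed


section \<open>Invariance of absolute invariants\<close>

lemma GL_inv:
  assumes "vector_space scale" "C \<in> GL scale"
  shows "inv_into UNIV C \<in> GL scale"
proof -
  have C: "Vector_Spaces.linear scale scale C" "bij C"
    using assms(2) by (simp_all add: GL_def)
  then have C_add: "C (x + y) = C x + C y" and C_scale: "C (scale c x) = scale c (C x)" for x y c
    by (simp_all add: Vector_Spaces.linear_iff)
  have s: "C (inv_into UNIV C y) = y" and i: "inv_into UNIV C (C x) = x" for x y
    using C(2) by (simp_all add: bij_is_surj surj_f_inv_f bij_is_inj)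
  have "inv_into UNIV C (x + y) = inv_into UNIV C x + inv_into UNIV C y"
    "inv_into UNIV C (scale c x) = scale c (inv_into UNIV C x)" for x y c
    by (metis s i C_add, metis s i C_scale)
  with assms(1) C(2) show ?thesis
    by (simp add: GL_def Vector_Spaces.linear_iff bij_imp_bij_inv)
qed

lemma forms_compose_linear:
  assumes "Vector_Spaces.linear scale scale T" "Q \<in> forms scale n"
  shows "Q \<circ> T \<in> forms scale n"
proof -
  have T: "T (x + y) = T x + T y" "T (scale c x) = scale c (T x)" for x y c
    using assms(1) by (simp_all add: Vector_Spaces.linear_iff)
  have "homogeneous scale n Q" using assms(2) by (simp add: forms_def)
  then have "homogeneous scale n (\<lambda>w. Q (T w))"
  proof (induction rule: homogeneous.induct)
    case (linear f)
    then show ?case by (intro homogeneous.linear) (simp add: linear_form_on_def T)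
  qed (auto intro: homogeneous.intros)
  then show ?thesis by (simp add: forms_def comp_def)
qed

lemma polynomial_on_forms_compose_linear:
  assumes T: "Vector_Spaces.linear scale scale T" and F: "polynomial_on_forms scale n F"
  shows "polynomial_on_forms scale n (\<lambda>Q. F (Q \<circ> T))"
  using F unfolding polynomial_on_forms_def
proof (induction rule: polynomial_on.induct)
  case (linear f)
  have comp: "(Q + R) \<circ> T = (Q \<circ> T) + (R \<circ> T)" "(\<lambda>w. c * Q w) \<circ> T = (\<lambda>w. c * (Q \<circ> T) w)"
    for c and Q R :: "'a \<Rightarrow> complex"
    by (simp_all add: fun_eq_iff)
  show ?case
  proof (rule polynomial_on.linear, unfold linear_form_on_def, intro conjI ballI allI)
    fix Q R assume "Q \<in> forms scale n" "R \<in> forms scale n"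
    then have "Q \<circ> T \<in> forms scale n" "R \<circ> T \<in> forms scale n"
      by (simp_all add: forms_compose_linear[OF T])
    then show "f ((Q + R) \<circ> T) = f (Q \<circ> T) + f (R \<circ> T)"
      and "f ((\<lambda>w. c * Q w) \<circ> T) = c * f (Q \<circ> T)" for c
      using linear unfolding comp linear_form_on_def by blast+
  qed
qed (auto intro: polynomial_on.intros)

text \<open>If \<open>F / G\<close> represents \<open>I / J\<close>, so does \<open>F (R \<circ> C\<inverse>) / G (R \<circ> C\<inverse>)\<close>: both \<open>I\<close> and \<open>J\<close>
  change by the same power of the determinant of \<open>C\<close>.\<close>

lemma rational_value_compose_inv:
  assumes W: "vector_space scale" and I: "form_invariant scale n k I" and J: "form_invariant scale n k J"
    and C: "C \<in> GL scale" and z: "rational_value scale n I J (Q \<circ> inv_into UNIV C) z"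
  shows "rational_value scale n I J Q z"
proof -
  let ?T = "inv_into UNIV C"
  have T: "Vector_Spaces.linear scale scale ?T"
    using GL_inv[OF W C] by (simp add: GL_def)
  obtain F G where FG: "polynomial_on_forms scale n F" "polynomial_on_forms scale n G"
    "\<And>R. R \<in> forms scale n \<Longrightarrow> F R * J R = I R * G R"
    "G (Q \<circ> ?T) \<noteq> 0" "z = F (Q \<circ> ?T) / G (Q \<circ> ?T)"
    using z unfolding rational_value_def by blast
  have "F (R \<circ> ?T) * J R = I R * G (R \<circ> ?T)" if R: "R \<in> forms scale n" for R
  proof -
    let ?d = "vector_space.lin_det scale C ^ k"
    have "F (R \<circ> ?T) * J R = ?d * (F (R \<circ> ?T) * J (R \<circ> ?T))"
      using J R C by (simp add: form_invariant_def)
    also have "\<dots> = ?d * (I (R \<circ> ?T) * G (R \<circ> ?T))"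
      by (simp add: FG(3) forms_compose_linear[OF T R])
    also have "\<dots> = I R * G (R \<circ> ?T)"
      using I R C by (simp add: form_invariant_def)
    finally show ?thesis .
  qed
  then show ?thesis
    unfolding rational_value_def
    using polynomial_on_forms_compose_linear[OF T] FG by blast
qed

lemma absolute_invariant_linearly_equivalent:
  assumes W: "vector_space scale" and inv: "absolute_invariant scale n \<I>"
    and Q: "Q \<in> forms scale n" and T: "T \<in> GL scale"
  shows "\<I> (Q \<circ> T) = \<I> Q"
proof -
  obtain k I J where IJ: "form_invariant scale n k I" "form_invariant scale n k J"
    "\<And>Q. Q \<in> forms scale n \<Longrightarrow> \<I> Q = rational_function scale n I J Q"
    using inv unfolding absolute_invariant_def by blast
  let ?C = "inv_into UNIV T"
  have C: "?C \<in> GL scale" using W T by (rule GL_inv)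
  have "bij T" using T by (simp add: GL_def)
  then have "Q \<circ> T \<circ> ?C = Q" "inv_into UNIV ?C = T"
    by (simp_all add: fun_eq_iff bij_is_surj surj_f_inv_f inv_inv_eq)
  then have "rational_value scale n I J (Q \<circ> T) = rational_value scale n I J Q"
    using rational_value_compose_inv[OF W IJ(1,2) C, of Q]
      rational_value_compose_inv[OF W IJ(1,2) T, of "Q \<circ> T"] by (intro ext) auto
  then have "rational_function scale n I J (Q \<circ> T) = rational_function scale n I J Q"
    by (simp add: rational_function_def)
  moreover have "Q \<circ> T \<in> forms scale n"
    using T Q by (intro forms_compose_linear) (simp_all add: GL_def)
  ultimately show ?thesis using IJ(3) Q by simp
qed


section \<open>Isomorphic algebras have linearly equivalent components\<close>

text \<open>Both maps identify \<open>W\<close> with the quotient of \<open>V\<close> by the common kernel; \<open>T\<close> is the resulting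
  change of identification, computed with a linear section of \<open>q\<close>.\<close>

lemma linear_maps_with_same_kernel:
  assumes p: "Vector_Spaces.linear scale scaleW p" "p ` V = UNIV"
    and q: "Vector_Spaces.linear scale scaleW q" "q ` V = UNIV"
    and V: "module.subspace scale V" and ker: "\<And>x. x \<in> V \<Longrightarrow> p x = 0 \<longleftrightarrow> q x = 0"
  shows "\<exists>T\<in>GL scaleW. \<forall>x\<in>V. p x = T (q x)"
proof -
  interpret p: Vector_Spaces.linear scale scaleW p by (fact p(1))
  interpret q: Vector_Spaces.linear scale scaleW q by (fact q(1))
  interpret vp: vector_space_pair scale scaleW ..
  obtain l where l: "range l \<subseteq> V" "Vector_Spaces.linear scaleW scale l" "\<And>w. q (l w) = w"
    using vp.linear_exists_right_inverse_on[OF q(1) V] q(2) by auto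
  interpret l: Vector_Spaces.linear scaleW scale l by (fact l(2))
  have lV: "l w \<in> V" for w using l(1) by auto
  have eq: "p x = p (l (q x))" if "x \<in> V" for x
  proof -
    have "x - l (q x) \<in> V" using that lV V by (intro p.vs1.subspace_diff)
    moreover have "q (x - l (q x)) = 0" by (simp add: q.diff l(3))
    ultimately have "p (x - l (q x)) = 0" using ker by blast
    then show ?thesis by (simp add: p.diff)
  qed
  have lin: "Vector_Spaces.linear scaleW scaleW (p \<circ> l)"
    by (rule Vector_Spaces.linear_compose[OF l(2) p(1)])
  interpret pl: Vector_Spaces.linear scaleW scaleW "p \<circ> l" by (fact lin)
  have "inj (p \<circ> l)"
    using ker[OF lV] l(3) by (subst pl.inj_iff_eq_0) simp
  moreover have "surj (p \<circ> l)"
  proof (rule surjI)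
    show "(p \<circ> l) (q (SOME x. x \<in> V \<and> p x = v)) = v" for v
    proof -
      have "\<exists>x. x \<in> V \<and> p x = v" using p(2) by (metis UNIV_I imageE)
      from someI_ex[OF this] show ?thesis by (simp add: eq[symmetric])
    qed
  qed
  ultimately have "p \<circ> l \<in> GL scaleW" using lin by (simp add: GL_def bij_def)
  with eq show ?thesis by (intro bexI[of _ "p \<circ> l"]) simp_all
qed

theorem theorem2p2:
  fixes scaleA :: "complex \<Rightarrow> 'a::comm_ring_1 \<Rightarrow> 'a" and \<mm>A HA :: "'a set" and PA :: "'a \<Rightarrow> complex"
    and scaleB :: "complex \<Rightarrow> 'b::comm_ring_1 \<Rightarrow> 'b" and \<mm>B HB :: "'b set" and PB :: "'b \<Rightarrow> complex"
    and scaleW :: "complex \<Rightarrow> 'w::ab_group_add \<Rightarrow> 'w"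
    and \<psi>A :: "'w \<Rightarrow> 'a set" and \<psi>B :: "'w \<Rightarrow> 'b set"
    and \<I> :: "('w \<Rightarrow> complex) \<rightharpoonup> complex" and s :: nat
  assumes "gorenstein_algebra scaleA \<mm>A" and "complex_algebra.graded scaleA"
    and "2 < vector_space.dim scaleA (UNIV :: 'a set)"
    and "gorenstein_algebra scaleB \<mm>B" and "complex_algebra.graded scaleB"
    and "algebras_isomorphic scaleA scaleB"
    and "complex_algebra.nil_polynomial scaleA \<mm>A HA PA"
    and "complex_algebra.nil_polynomial scaleB \<mm>B HB PB"
    and "s \<in> {2..nil_index \<mm>A}"
    and "vector_space scaleW"
    and "complex_algebra.quotient_iso scaleA scaleW \<mm>A (ideal_pow \<mm>A (nil_index \<mm>A + 2 - s)) \<psi>A"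
    and "complex_algebra.quotient_iso scaleB scaleW \<mm>B (ideal_pow \<mm>B (nil_index \<mm>B + 2 - s)) \<psi>B"
    and "absolute_invariant scaleW s \<I>"
  shows "\<I> (complex_algebra.nil_component scaleA \<mm>A HA PA s \<circ> \<psi>A) =
         \<I> (complex_algebra.nil_component scaleB \<mm>B HB PB s \<circ> \<psi>B)"
proof -
  interpret A: gorenstein_algebra scaleA \<mm>A by fact
  interpret B: gorenstein_algebra scaleB \<mm>B by fact
  interpret W: vector_space scaleW by fact
  let ?UA = "ideal_pow \<mm>A (nil_index \<mm>A + 2 - s)" and ?UB = "ideal_pow \<mm>B (nil_index \<mm>B + 2 - s)"
  obtain \<phi> where \<phi>: "algebra_iso scaleA scaleB \<phi>"
    using assms(6) by (auto simp: algebras_isomorphic_def)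
  then have \<phi>_lin: "Vector_Spaces.linear scaleA scaleB \<phi>" by (simp add: algebra_iso_def)
  interpret \<phi>: ring_iso \<phi>
    using \<phi> by unfold_locales (auto simp: algebra_iso_def Vector_Spaces.linear_iff)
  have MB: "\<mm>B = \<phi> ` \<mm>A" using B.local[OF \<phi>.image_maximal_ideal[OF A.maximal]] by simp
  have \<nu>: "nil_index \<mm>B = nil_index \<mm>A" by (simp add: MB \<phi>.nil_index_image)
  have UB: "?UB = \<phi> ` ?UA" unfolding \<nu> by (simp add: MB \<phi>.image_ideal_pow)
  have s: "0 < s" "s \<in> {2..nil_index \<mm>B}" using assms(9) \<nu> by auto
  have "ideal_pow \<mm>A 1 \<subseteq> \<mm>A"
    using ideal_prod_subset[OF A.ideal_M, of \<mm>A UNIV] is_ideal_mult_right[OF A.ideal_M] by simp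
  moreover have "?UA \<subseteq> ideal_pow \<mm>A 1"
  proof (rule ideal_pow_antimono)
    show "1 \<le> nil_index \<mm>A + 2 - s"
      using assms(9) unfolding atLeastAtMost_iff by linarith
  qed
  ultimately have UA_sub: "?UA \<subseteq> \<mm>A" by simp
  then have UB_sub: "?UB \<subseteq> \<mm>B" unfolding UB unfolding MB by (rule image_mono)

  obtain \<pi>A where \<pi>A: "Vector_Spaces.linear scaleA scaleW \<pi>A" "\<And>w. \<psi>A w = {x \<in> \<mm>A. \<pi>A x = w}"
    "\<pi>A ` \<mm>A = UNIV" "\<And>x. x \<in> \<mm>A \<Longrightarrow> \<pi>A x = 0 \<longleftrightarrow> x \<in> ?UA"
    using A.quotient_iso_linear_map[OF assms(11,10) A.subspace_ideal[OF A.ideal_M]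
        A.subspace_ideal[OF is_ideal_ideal_pow] UA_sub] by blast
  obtain \<pi>B where \<pi>B: "Vector_Spaces.linear scaleB scaleW \<pi>B" "\<And>w. \<psi>B w = {x \<in> \<mm>B. \<pi>B x = w}"
    "\<pi>B ` \<mm>B = UNIV" "\<And>x. x \<in> \<mm>B \<Longrightarrow> \<pi>B x = 0 \<longleftrightarrow> x \<in> ?UB"
    using B.quotient_iso_linear_map[OF assms(12,10) B.subspace_ideal[OF B.ideal_M]
        B.subspace_ideal[OF is_ideal_ideal_pow] UB_sub] by blast

  define \<omega>A where "\<omega>A = (SOME \<omega>. A.nil_form \<mm>A HA PA \<omega>)"
  define \<omega>B where "\<omega>B = (SOME \<omega>. B.nil_form \<mm>B HB PB \<omega>)"
  have "A.nil_form \<mm>A HA PA \<omega>A"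
    using assms(7) unfolding A.nil_polynomial_def \<omega>A_def
    by (rule someI_ex[of "A.nil_form \<mm>A HA PA", OF conjunct2])
  then have \<omega>A: "linear_form_on scaleA \<mm>A \<omega>A" "\<omega>A ` Ann \<mm>A = UNIV"
    by (simp_all add: A.nil_form_def)
  have "B.nil_form \<mm>B HB PB \<omega>B"
    using assms(8) unfolding B.nil_polynomial_def \<omega>B_def
    by (rule someI_ex[of "B.nil_form \<mm>B HB PB", OF conjunct2])
  then have \<omega>B: "linear_form_on scaleB \<mm>B \<omega>B" "\<omega>B ` Ann \<mm>B = UNIV"
    by (simp_all add: B.nil_form_def)
  have \<omega>B': "linear_form_on scaleA \<mm>A (\<omega>B \<circ> \<phi>)"
    using \<omega>B(1) \<phi>_lin unfolding linear_form_on_def MB Vector_Spaces.linear_iff by simp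
  have "(\<omega>B \<circ> \<phi>) ` Ann \<mm>A = UNIV"
    using \<omega>B(2) unfolding MB \<phi>.image_Ann[symmetric] by (simp add: image_comp)
  then obtain b where b: "b \<notin> \<mm>A" "\<And>u. u \<in> \<mm>A \<Longrightarrow> \<omega>B (\<phi> (u ^ s)) = \<omega>A ((b * u) ^ s)"
    using A.power_forms_differ_by_unit[OF \<omega>A \<omega>B' _ s(1)] by auto
  obtain b' where b': "b * b' = 1" using b(1) A.invertible_iff_notin_M by blast
  have cancel: "b * u \<in> K \<longleftrightarrow> u \<in> K" if "is_ideal K" for u K
    using is_ideal_mult_left[OF that, of u b] is_ideal_mult_left[OF that, of "b * u" b'] b'
    by (metis mult.assoc mult.commute mult_1)
  let ?QA = "A.nil_component \<mm>A HA PA s \<circ> \<psi>A" and ?QB = "B.nil_component \<mm>B HB PB s \<circ> \<psi>B"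
  have QA: "?QA (\<pi>A x) = 1 / fact s * \<omega>A (x ^ s)" if "x \<in> \<mm>A" for x
    using A.nil_component_eq[OF \<pi>A(1,2) _ assms(9) that] \<pi>A(4) by (simp add: \<omega>A_def)
  have QB: "?QB (\<pi>B x) = 1 / fact s * \<omega>B (x ^ s)" if "x \<in> \<mm>B" for x
    using B.nil_component_eq[OF \<pi>B(1,2) _ s(2) that] \<pi>B(4) by (simp add: \<omega>B_def)
  have "?QA \<in> forms scaleW s"
    using A.nil_component_mem_forms[OF assms(10) \<pi>A(1,3) \<omega>A(1) s(1)] QA by blast

  \<comment> \<open>Both maps have the kernel \<open>?UA\<close> on \<open>\<mm>A\<close>, as \<open>b\<close> is a unit and \<open>\<phi>\<close> carries \<open>?UA\<close> to \<open>?UB\<close>.\<close>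
  have "\<exists>T\<in>GL scaleW. \<forall>x\<in>\<mm>A. (\<pi>A \<circ> (*) b) x = T ((\<pi>B \<circ> \<phi>) x)"
  proof (rule linear_maps_with_same_kernel)
    show "Vector_Spaces.linear scaleA scaleW (\<pi>A \<circ> (*) b)"
      using A.linear_mult_left \<pi>A(1) by (rule Vector_Spaces.linear_compose)
    show "Vector_Spaces.linear scaleA scaleW (\<pi>B \<circ> \<phi>)"
      using \<phi>_lin \<pi>B(1) by (rule Vector_Spaces.linear_compose)
    have "(*) b ` \<mm>A = \<mm>A"
    proof (intro Set.set_eqI iffI)
      show "x \<in> \<mm>A" if "x \<in> (*) b ` \<mm>A" for x
        using that is_ideal_mult_left[OF A.ideal_M] by auto
      show "x \<in> (*) b ` \<mm>A" if "x \<in> \<mm>A" for x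
      proof (rule image_eqI)
        show "x = b * (b' * x)" by (simp add: mult.assoc[symmetric] b')
        show "b' * x \<in> \<mm>A" using A.ideal_M that by (rule is_ideal_mult_left)
      qed
    qed
    then show "(\<pi>A \<circ> (*) b) ` \<mm>A = UNIV"
      using \<pi>A(3) by (simp only: image_comp[symmetric])
    show "(\<pi>B \<circ> \<phi>) ` \<mm>A = UNIV"
      using \<pi>B(3) by (simp only: MB image_comp)
    show "A.subspace \<mm>A" using A.ideal_M by (rule A.subspace_ideal)
    fix x assume x: "x \<in> \<mm>A"
    then have "(\<pi>A \<circ> (*) b) x = 0 \<longleftrightarrow> b * x \<in> ?UA"
      using \<pi>A(4) is_ideal_mult_left[OF A.ideal_M] by simp
    also have "\<dots> \<longleftrightarrow> \<phi> x \<in> ?UB"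
      unfolding UB \<phi>.image_mem_iff by (rule cancel[OF is_ideal_ideal_pow])
    also have "\<dots> \<longleftrightarrow> (\<pi>B \<circ> \<phi>) x = 0"
      using x \<pi>B(4)[of "\<phi> x"] by (simp add: MB)
    finally show "(\<pi>A \<circ> (*) b) x = 0 \<longleftrightarrow> (\<pi>B \<circ> \<phi>) x = 0" .
  qed
  then obtain T where T: "T \<in> GL scaleW" "\<And>x. x \<in> \<mm>A \<Longrightarrow> \<pi>A (b * x) = T (\<pi>B (\<phi> x))"
    by auto
  have "?QB w = (?QA \<circ> T) w" for w
  proof -
    obtain x where x: "x \<in> \<mm>A" "w = \<pi>B (\<phi> x)"
      using \<pi>B(3) unfolding MB by (metis UNIV_I imageE)
    have "?QB w = 1 / fact s * \<omega>B (\<phi> x ^ s)"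
      unfolding x(2) by (rule QB) (simp add: MB x(1))
    also have "\<dots> = 1 / fact s * \<omega>A ((b * x) ^ s)"
      by (simp add: b(2)[OF x(1)] \<phi>.map_power[symmetric])
    also have "\<dots> = ?QA (\<pi>A (b * x))"
      by (rule QA[symmetric]) (rule is_ideal_mult_left[OF A.ideal_M x(1)])
    finally show ?thesis by (simp add: x(2) T(2)[OF x(1)])
  qed
  then have "?QB = ?QA \<circ> T" by (rule ext)
  then show ?thesis
    using absolute_invariant_linearly_equivalent[OF assms(10,13) \<open>?QA \<in> forms scaleW s\<close> T(1)] by simp
qed

end
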